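(* Let $(\psi,\mathcal X,\mathcal Y,\mathcal U,\mathcal P,\|\cdot\|,r)$ be a dual-extraction setup (defined in the context), let $y_0\in\mathcal Y\cap\operatorname{int}\mathcal P$, $K\in\mathbb N$, $\lambda_0,\dots,\lambda_{K-1}>0$, $\epsilon_1,\dots,\epsilon_K>0$, and let $\Lambda_k:=\sum_{j=0}^{k-1}\lambda_j$ for $k\in\{1,\dots,K\}$. Let $y^\star\in\operatorname{argmax}_{y\in\mathcal Y}\phi(y)$. With $K$ calls to a DRPO oracle and $K$ calls to a DRBR oracle, the dual-extraction framework (defined in the context) run with these inputs returns $y_K$ satisfying $$\mathbb E\,V_{y_K}(u)\le\frac{\epsilon_K}{\Lambda_K},$$ where $u\in\mathcal Y$ is a (random) point with expected suboptimality bounded as $$\phi(y^\star)-\mathbb E\,\phi(u)\le\lambda_0V_{y_0}(y^\star)+\sum_{k=1}^{K-1}\frac{\lambda_k}{\Lambda_k}\epsilon_k .$$ If additionally $\phi$ is $L$-Lipschitz with respect to $\|\cdot\|$, then $$\phi(y^\star)-\mathbb E\,\phi(y_K)\le\lambda_0V_{y_0}(y^\star)+\sum_{k=1}^{K-1}\frac{\lambda_k}{\Lambda_k}\epsilon_k+L\sqrt{\frac{2}{\mu_r}\cdot\frac{\epsilon_K}{\Lambda_K}} .$$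
   Context: Dgf setup. $(\mathcal U,\mathcal P,\|\cdot\|,r)$ is a dgf setup over $\mathbb R^n$ if $\mathcal U\subseteq\mathcal P\subseteq\mathbb R^n$ are closed convex sets with $\mathcal U\cap\operatorname{int}\mathcal P\ne\emptyset$, $\|\cdot\|$ is a norm on $\mathbb R^n$, and: (i) $r:\mathcal P\to\mathbb R$ is convex and continuous on $\mathcal P$, differentiable on $\operatorname{int}\mathcal P$, and $\mu_r$-strongly convex with respect to $\|\cdot\|$ on $\mathcal U\cap\operatorname{int}\mathcal P$ for some $\mu_r>0$; (ii) either $\lim_{u\to\operatorname{bd}\mathcal P}\|\nabla r(u)\|_2=\infty$ or $\mathcal U\subseteq\operatorname{int}\mathcal P$. Its Bregman divergence is $V_u(v):=r(v)-r(u)-\langle\nabla r(u),v-u\rangle$ for $u\in\operatorname{int}\mathcal P$, $v\in\mathcal P$. Dual-extraction setup. A tuple $(\psi,\mathcal X,\mathcal Y,\mathcal U,\mathcal P,\|\cdot\|,r)$ with $\psi:\mathbb R^d\times\mathbb R^n\to\mathbb R$ such that: (i) $\psi(x,\cdot)$ is differentiable for every $x$; (ii) $\psi(\cdot,y)$ is convex for every $y$ and $\psi(x,\cdot)$ is concave for every $x$; (iii) $(\mathcal U,\mathcal P,\|\cdot\|,r)$ is a dgf setup over $\mathbb R^n$; (iv) $\mathcal X\subseteq\mathbb R^d$ and $\mathcal Y\subseteq\mathbb R^n$ are nonempty, closed, convex, with $\mathcal Y\subseteq\mathcal U$ and $\mathcal Y\cap\operatorname{int}\mathcal P\neq\emptyset$;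 (v) $\mathcal X$ is bounded or $\psi(\cdot,y)$ is strongly convex for every $y$; (vi) $\mathcal Y$ is bounded or $\psi(x,\cdot)$ is strongly concave for every $x$; (vii) for all $p\in\mathcal U\cap\operatorname{int}\mathcal P$ and all $w\in\partial\mathbb I_{\mathcal U}(p)$ (with $\mathbb I_{\mathcal U}$ the $0/\infty$ indicator of $\mathcal U$), the map $y\mapsto\langle w,y\rangle$ is constant over $\mathcal Y$. Notation. $f(x):=\max_{y\in\mathcal Y}\psi(x,y)$ on $\mathcal X$; $\phi(y):=\min_{x\in\mathcal X}\psi(x,y)$ on $\mathcal Y$; for $\lambda>0$ and $q\in\mathcal U\cap\operatorname{int}\mathcal P$, $f_{\lambda,q}(x):=\max_{y\in\mathcal Y}\{\psi(x,y)-\lambda V_q(y)\}$ on $\mathcal X$. Oracles. $\mathrm{DRPO}(q,\lambda,\epsilon_{\mathrm p})$ returns a (possibly random) $x\in\mathcal X$ with $\mathbb E f_{\lambda,q}(x)\le\inf_{x'\in\mathcal X}f_{\lambda,q}(x')+\epsilon_{\mathrm p}$, the expectation being over the oracle's internal randomness. $\mathrm{DRBR}(q,\lambda,x)$ returns $\operatorname{argmax}_{y\in\mathcal Y}\{\psi(x,y)-\lambda V_q(y)\}$. Dual-extraction framework. For $k=1,\dots,K$: set $\Lambda_k=\sum_{j=0}^{k-1}\lambda_j$; $q_k=\operatorname{argmin}_{q\in\mathcal U}\frac1{\Lambda_k}\sum_{j=0}^{k-1}\lambda_jV_{y_j}(q)$; $x_k=\mathrm{DRPO}(q_k,\Lambda_k,\epsilon_k)$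 (the oracle guarantee holds conditionally on the previously generated iterates); $y_k=\mathrm{DRBR}(q_k,\Lambda_k,x_k)$. Return $y_K$. Expectations in the claim are over the randomness of all DRPO calls. *)

theory Defs
  imports "HOL-Probability.Probability"
begin

section \<open>Convex analysis\<close>

definition is_norm :: "('a::real_vector \<Rightarrow> real) \<Rightarrow> bool" where
  "is_norm N \<longleftrightarrow>
     (\<forall>v. N v = 0 \<longleftrightarrow> v = 0) \<and>
     (\<forall>c v. N (c *\<^sub>R v) = \<bar>c\<bar> * N v) \<and>
     (\<forall>v w. N (v + w) \<le> N v + N w)"

definition strongly_convex_on ::
    "('a::real_vector \<Rightarrow> real) \<Rightarrow> real \<Rightarrow> 'a set \<Rightarrow> ('a \<Rightarrow> real) \<Rightarrow> bool" where
  "strongly_convex_on N \<mu> S g \<longleftrightarrow>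
     convex S \<and>
     (\<forall>v\<in>S. \<forall>w\<in>S. \<forall>t\<in>{0..1}.
        g (t *\<^sub>R v + (1 - t) *\<^sub>R w)
          \<le> t * g v + (1 - t) * g w - \<mu> / 2 * t * (1 - t) * (N (v - w))\<^sup>2)"

definition gradient :: "('a::real_inner \<Rightarrow> real) \<Rightarrow> 'a \<Rightarrow> 'a" where
  "gradient g u = (THE D. GDERIV g u :> D)"

definition convex_indicator :: "'a set \<Rightarrow> 'a \<Rightarrow> ereal" where
  "convex_indicator S v = (if v \<in> S then 0 else \<infinity>)"

definition subdifferential :: "('a::real_inner \<Rightarrow> ereal) \<Rightarrow> 'a \<Rightarrow> 'a set" where
  "subdifferential g p = {w. \<forall>v. g v \<ge> g p + ereal (w \<bullet> (v - p))}"

definition lipschitz_wrt ::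
    "('a::real_vector \<Rightarrow> real) \<Rightarrow> real \<Rightarrow> 'a set \<Rightarrow> ('a \<Rightarrow> real) \<Rightarrow> bool" where
  "lipschitz_wrt N L S g \<longleftrightarrow>
     0 \<le> L \<and> (\<forall>v\<in>S. \<forall>w\<in>S. \<bar>g v - g w\<bar> \<le> L * N (v - w))"

definition bregman :: "('a::real_inner \<Rightarrow> real) \<Rightarrow> 'a \<Rightarrow> 'a \<Rightarrow> real" where
  "bregman r u v = r v - r u - gradient r u \<bullet> (v - u)"


section \<open>Setups\<close>

text \<open>
  The function \<open>r\<close> is only meaningful on \<open>P\<close>; its values elsewhere are never used. The strong
  convexity modulus \<open>\<mu>\<close> is an explicit parameter because it occurs in error bounds.
\<close>

locale dgf_setup =
  fixes U P :: "(real^'n) set" and N :: "real^'n \<Rightarrow> real"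
    and r :: "real^'n \<Rightarrow> real" and \<mu> :: real
  assumes U_subset_P: "U \<subseteq> P"
    and closed_U: "closed U" and convex_U: "convex U"
    and closed_P: "closed P" and convex_P: "convex P"
    and U_meets_interior: "U \<inter> interior P \<noteq> {}"
    and norm_N: "is_norm N"
    and convex_r: "convex_on P r"
    and continuous_r: "continuous_on P r"
    and differentiable_r: "\<And>u. u \<in> interior P \<Longrightarrow> r differentiable (at u)"
    and \<mu>_pos: "\<mu> > 0"
    and strongly_convex_r: "strongly_convex_on N \<mu> (U \<inter> interior P) r"
    and boundary:
      "(\<forall>p\<in>frontier P. filterlim (\<lambda>u. norm (gradient r u)) at_top (at p within interior P))
       \<or> U \<subseteq> interior P"

text \<open>
  Strong convexity and concavity of \<open>psi\<close> are taken with respect to the Euclidean norm and with a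
  modulus that may depend on the frozen argument; since all norms on a finite-dimensional space are
  equivalent, the choice of norm does not matter.
\<close>

locale dual_extraction_setup = dgf_setup U P N r \<mu>
  for psi :: "real^'d \<Rightarrow> real^'n \<Rightarrow> real"
    and X :: "(real^'d) set" and Y :: "(real^'n) set"
    and U P :: "(real^'n) set" and N :: "real^'n \<Rightarrow> real"
    and r :: "real^'n \<Rightarrow> real" and \<mu> :: real +
  assumes differentiable_psi: "\<And>x y. (\<lambda>v. psi x v) differentiable (at y)"
    and convex_psi: "\<And>y. convex_on UNIV (\<lambda>x. psi x y)"
    and concave_psi: "\<And>x. concave_on UNIV (\<lambda>y. psi x y)"
    and X_nonempty: "X \<noteq> {}" and closed_X: "closed X" and convex_X: "convex X"
    and Y_nonempty: "Y \<noteq> {}" and closed_Y: "closed Y" and convex_Y: "convex Y"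
    and Y_subset_U: "Y \<subseteq> U"
    and Y_meets_interior: "Y \<inter> interior P \<noteq> {}"
    and X_bounded_or_strongly_convex:
      "bounded X \<or> (\<forall>y. \<exists>m>0. strongly_convex_on norm m UNIV (\<lambda>x. psi x y))"
    and Y_bounded_or_strongly_concave:
      "bounded Y \<or> (\<forall>x. \<exists>m>0. strongly_convex_on norm m UNIV (\<lambda>y. - psi x y))"
    and normal_constant_on_Y:
      "\<And>p w. p \<in> U \<inter> interior P \<Longrightarrow> w \<in> subdifferential (convex_indicator U) p \<Longrightarrow>
         (\<lambda>y. w \<bullet> y) constant_on Y"


section \<open>Objectives\<close>

text \<open>
  In a dual-extraction setup the infimum and supremum below are attained (the latter for
  \<open>lam > 0\<close> and \<open>q \<in> U \<inter> interior P\<close>), so they are the minimum over \<open>X\<close> and the maximum over \<open>Y\<close>.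
\<close>

definition dual_objective ::
    "('a \<Rightarrow> 'b \<Rightarrow> real) \<Rightarrow> 'a set \<Rightarrow> 'b \<Rightarrow> real" where
  "dual_objective psi X y = (INF x\<in>X. psi x y)"

definition reg_primal_objective ::
    "('a \<Rightarrow> 'b::real_inner \<Rightarrow> real) \<Rightarrow> 'b set \<Rightarrow> ('b \<Rightarrow> real) \<Rightarrow> real \<Rightarrow> 'b \<Rightarrow> 'a \<Rightarrow> real" where
  "reg_primal_objective psi Y r lam q x = (SUP y\<in>Y. psi x y - lam * bregman r q y)"


section \<open>Oracles and the dual-extraction framework\<close>

text \<open>
  The guarantee of the primal oracle for a query \<open>q\<close> that may itself be random, conditionally on a
  sub-sigma-algebra \<open>F\<close> of \<open>M\<close>; for constant \<open>q\<close> and trivial \<open>F\<close> it is the unconditional one.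
  Global integrability of the objective at the returned point is not required. It is enough that
  its conditional expectation is well defined and finite: the first conjunct under \<open>AE\<close> says so
  for the positive part, while the negative part is controlled by the infimum, which is a function
  of \<open>q\<close> alone. Without the first conjunct, an infinite conditional expectation would
  be read as a finite number by \<open>real_cond_exp\<close>.
\<close>

definition drpo_response ::
    "'w measure \<Rightarrow> 'w measure \<Rightarrow> ('a::euclidean_space \<Rightarrow> 'b::euclidean_space \<Rightarrow> real) \<Rightarrow>
     'a set \<Rightarrow> 'b set \<Rightarrow> ('b \<Rightarrow> real) \<Rightarrow> ('w \<Rightarrow> 'b) \<Rightarrow> real \<Rightarrow> real \<Rightarrow> ('w \<Rightarrow> 'a) \<Rightarrow> bool" where
  "drpo_response M F psi X Y r q lam eps x \<longleftrightarrow>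
     x \<in> borel_measurable M \<and>
     (\<forall>\<omega>\<in>space M. x \<omega> \<in> X) \<and>
     (AE \<omega> in M.
        nn_cond_exp M F (\<lambda>\<omega>. ennreal (reg_primal_objective psi Y r lam (q \<omega>) (x \<omega>))) \<omega> < \<infinity> \<and>
        real_cond_exp M F (\<lambda>\<omega>. reg_primal_objective psi Y r lam (q \<omega>) (x \<omega>)) \<omega>
          \<le> (INF x'\<in>X. reg_primal_objective psi Y r lam (q \<omega>) x') + eps)"

definition drbr_response ::
    "('a \<Rightarrow> 'b::real_inner \<Rightarrow> real) \<Rightarrow> 'b set \<Rightarrow> ('b \<Rightarrow> real) \<Rightarrow> 'b \<Rightarrow> real \<Rightarrow> 'a \<Rightarrow> 'b \<Rightarrow> bool" where
  "drbr_response psi Y r q lam x y \<longleftrightarrow>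
     is_arg_max (\<lambda>v. psi x v - lam * bregman r q v) (\<lambda>v. v \<in> Y) y"

text \<open>
  The sigma-algebra generated by \<open>x 1, \<dots>, x (k - 1)\<close>. Given the deterministic starting point, the
  iterates \<open>q j\<close> and \<open>y j\<close> are functions of these, being unique minimizers and maximizers.
\<close>

definition history ::
    "'w measure \<Rightarrow> (nat \<Rightarrow> 'w \<Rightarrow> 'a::topological_space) \<Rightarrow> nat \<Rightarrow> 'w measure" where
  "history M x k =
     vimage_algebra (space M) (\<lambda>\<omega>. \<lambda>j\<in>{1..<k}. x j \<omega>) (PiM {1..<k} (\<lambda>_. borel))"

definition cumulative :: "(nat \<Rightarrow> real) \<Rightarrow> nat \<Rightarrow> real" where
  "cumulative lam k = (\<Sum>j<k. lam j)"

definition dual_extraction_run ::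
    "'w measure \<Rightarrow> ('a::euclidean_space \<Rightarrow> 'b::euclidean_space \<Rightarrow> real) \<Rightarrow>
     'a set \<Rightarrow> 'b set \<Rightarrow> 'b set \<Rightarrow> ('b \<Rightarrow> real) \<Rightarrow>
     'b \<Rightarrow> nat \<Rightarrow> (nat \<Rightarrow> real) \<Rightarrow> (nat \<Rightarrow> real) \<Rightarrow>
     (nat \<Rightarrow> 'w \<Rightarrow> 'b) \<Rightarrow> (nat \<Rightarrow> 'w \<Rightarrow> 'a) \<Rightarrow> (nat \<Rightarrow> 'w \<Rightarrow> 'b) \<Rightarrow> bool" where
  "dual_extraction_run M psi X Y U r y0 K lam eps q x y \<longleftrightarrow>
     (\<forall>\<omega>\<in>space M. y 0 \<omega> = y0) \<and>
     (\<forall>k\<in>{1..K}.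
        (\<forall>\<omega>\<in>space M.
           is_arg_min (\<lambda>p. 1 / cumulative lam k * (\<Sum>j<k. lam j * bregman r (y j \<omega>) p))
             (\<lambda>p. p \<in> U) (q k \<omega>)) \<and>
        drpo_response M (history M x k) psi X Y r (q k) (cumulative lam k) (eps k) (x k) \<and>
        (\<forall>\<omega>\<in>space M. drbr_response psi Y r (q k \<omega>) (cumulative lam k) (x k \<omega>) (y k \<omega>)))"

end

theory Submission
  imports Defs
begin

text \<open>
  Write \<open>V\<close> for the Bregman divergence, \<open>\<phi>\<close> for the dual objective, \<open>\<lambda>\<^sub>j\<close> and \<open>\<Lambda>\<^sub>k\<close> for the
  weights and their partial sums. For each step \<open>k\<close> let \<open>u\<^sub>k\<close> maximize over \<open>Y\<close> the
  regularized dual objective \<open>\<phi>(v) - \<Lambda>\<^sub>k V(q\<^sub>k, v)\<close>. Two facts about \<open>u\<^sub>k\<close> give everything.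

  First, the best response \<open>y\<^sub>k\<close> is close to \<open>u\<^sub>k\<close>. Since \<open>y\<^sub>k\<close> maximizes a concave function minus
  \<open>\<Lambda>\<^sub>k V(q\<^sub>k, \<cdot>)\<close>, every competitor, in particular \<open>u\<^sub>k\<close>, loses at least \<open>\<Lambda>\<^sub>k V(y\<^sub>k, u\<^sub>k)\<close>
  (\<open>bregman_proximal_point\<close>). By minimax duality the regularized value at \<open>u\<^sub>k\<close> is the infimum of
  the regularized primal objective (\<open>reg_minimax\<close>). Hence \<open>\<Lambda>\<^sub>k V(y\<^sub>k, u\<^sub>k)\<close> is at most the
  suboptimality of \<open>x\<^sub>k\<close> in the regularized primal problem (\<open>best_response_gap\<close>), whose conditional
  expectation the primal oracle bounds by \<open>\<epsilon>\<^sub>k\<close>.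

  Second, the regularizers accumulate. The optimality condition for \<open>q\<^sub>k\<close> produces a normal vector
  of \<open>U\<close> at \<open>q\<^sub>k\<close>, and normal vectors are constant on \<open>Y\<close>. Therefore \<open>\<Lambda>\<^sub>k V(q\<^sub>k, \<cdot>)\<close> and
  \<open>\<Sum>j<k. \<lambda>\<^sub>j V(y\<^sub>j, \<cdot>)\<close> differ on \<open>Y\<close> by a constant (\<open>bregman_step_constant_on_Y\<close>), so \<open>u\<^sub>k\<close>
  also maximizes \<open>\<phi> - (\<Sum>j<k. \<lambda>\<^sub>j V(y\<^sub>j, \<cdot>))\<close>. Passing from \<open>k\<close> to \<open>k + 1\<close> lowers this maximum by at
  most \<open>\<lambda>\<^sub>k V(y\<^sub>k, u\<^sub>k)\<close>, and telescoping bounds the suboptimality of \<open>u\<^sub>K\<close>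
  (\<open>accumulated_suboptimality\<close>). The Lipschitz estimate transfers this from \<open>u\<^sub>K\<close> to \<open>y\<^sub>K\<close> by
  strong convexity, which turns the bound on \<open>V(y\<^sub>K, u\<^sub>K)\<close> into one on the distance.

  For the expectations, only the points \<open>x\<^sub>k\<close> are given as random variables. Measurability of
  \<open>q\<^sub>k\<close>, \<open>y\<^sub>k\<close> and \<open>u\<^sub>k\<close> follows because each is the unique maximizer of a function that is
  measurable in the outcome and continuous in the point (\<open>borel_measurable_unique_maximizer\<close>).
  The conditional guarantee of the oracle concerns an objective that need not be integrable; it is
  integrated after subtracting the infimum, which leaves a nonnegative function
  (\<open>nn_integral_gap_le\<close>).
\<close>

section \<open>A minimax theorem with compact sublevel sets\<close>

text \<open>
  The values \<open>(h x, g x)\<close>, enlarged upwards, form a convex subset of the plane that avoids the open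
  quadrant below \<open>(\<alpha>, \<alpha>)\<close>. A separating line has a nonnegative normal vector, and normalizing it
  gives \<open>\<theta>\<close>.
\<close>

lemma convex_combination_of_two_alternatives:
  fixes h g :: "'a::real_vector \<Rightarrow> real"
  assumes h: "convex_on X h" and g: "convex_on X g"
    and alt: "\<And>x. x \<in> X \<Longrightarrow> \<alpha> \<le> h x \<or> \<alpha> \<le> g x"
  shows "\<exists>\<theta>\<in>{0..1}. \<forall>x\<in>X. \<alpha> \<le> \<theta> * h x + (1 - \<theta>) * g x"
proof (cases "X = {}")
  case True
  then show ?thesis by (auto intro: bexI[of _ 0])
next
  case False
  define S where "S = {p. \<exists>x\<in>X. h x \<le> fst p \<and> g x \<le> snd p}"
  define T where "T = {p::real \<times> real. fst p < \<alpha> \<and> snd p < \<alpha>}"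
  have cX: "convex X" using h by (simp add: convex_on_def)
  have "convex S"
    unfolding convex_def
  proof (intro ballI allI impI)
    fix p p' and s t :: real
    assume "p \<in> S" "p' \<in> S" and st: "0 \<le> s" "0 \<le> t" "s + t = 1"
    then obtain x x' where x: "x \<in> X" "h x \<le> fst p" "g x \<le> snd p"
      and x': "x' \<in> X" "h x' \<le> fst p'" "g x' \<le> snd p'"
      by (auto simp: S_def)
    have "h (s *\<^sub>R x + t *\<^sub>R x') \<le> s * h x + t * h x'" "g (s *\<^sub>R x + t *\<^sub>R x') \<le> s * g x + t * g x'"
      using h g st x x' by (auto simp: convex_on_def)
    moreover have "s * h x + t * h x' \<le> s * fst p + t * fst p'"
      "s * g x + t * g x' \<le> s * snd p + t * snd p'"
      using x x' st by (auto intro!: add_mono mult_left_mono)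
    moreover have "s *\<^sub>R x + t *\<^sub>R x' \<in> X" using cX st x x' by (simp add: convex_def)
    ultimately show "s *\<^sub>R p + t *\<^sub>R p' \<in> S"
      unfolding S_def by (auto intro!: bexI[of _ "s *\<^sub>R x + t *\<^sub>R x'"])
  qed
  moreover have "convex T"
  proof -
    have "T = {..<\<alpha>} \<times> {..<\<alpha>}" by (auto simp: T_def)
    then show ?thesis by (simp add: convex_Times)
  qed
  moreover have "S \<noteq> {}" using False by (force simp: S_def)
  moreover have "T \<noteq> {}"
  proof -
    have "(\<alpha> - 1, \<alpha> - 1) \<in> T" by (simp add: T_def)
    then show ?thesis by blast
  qed
  moreover have "T \<inter> S = {}"
  proof -
    have False if p: "p \<in> T" "p \<in> S" for p
    proof -
      obtain x where "x \<in> X" "h x \<le> fst p" "g x \<le> snd p" using p unfolding S_def by blast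
      moreover have "fst p < \<alpha>" "snd p < \<alpha>" using p by (auto simp: T_def)
      ultimately show False using alt[of x] by linarith
    qed
    then show ?thesis by blast
  qed
  ultimately obtain p c where p: "p \<noteq> 0" and T: "\<forall>z\<in>T. inner p z \<le> c" and S: "\<forall>z\<in>S. c \<le> inner p z"
    using separating_hyperplane_sets[of T S] by blast
  obtain u v where uv: "p = (u, v)" by (cases p)
  have T': "u * s + v * t \<le> c" if "s < \<alpha>" "t < \<alpha>" for s t
    using T that by (auto simp: T_def uv)
  have u: "u \<ge> 0"
  proof (rule ccontr)
    assume "\<not> u \<ge> 0"
    \<comment> \<open>If \<open>u < 0\<close>, a first coordinate that is negative enough takes a point of the quadrant \<open>T\<close> across the line.\<close>
    define s where "s = min (\<alpha> - 1) ((c - v * (\<alpha> - 1)) / u - 1)"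
    have "u * s \<ge> u * ((c - v * (\<alpha> - 1)) / u - 1)"
      using \<open>\<not> u \<ge> 0\<close> by (intro mult_left_mono_neg) (auto simp: s_def)
    moreover have "u * ((c - v * (\<alpha> - 1)) / u - 1) = c - v * (\<alpha> - 1) - u"
    proof -
      have "u * (d / u - 1) = d - u" for d using \<open>\<not> u \<ge> 0\<close> by (simp add: field_simps)
      then show ?thesis .
    qed
    ultimately have "u * s + v * (\<alpha> - 1) > c" using \<open>\<not> u \<ge> 0\<close> by linarith
    moreover have "s < \<alpha>" by (simp add: s_def min_def)
    ultimately show False using T'[of s "\<alpha> - 1"] by auto
  qed
  have v: "v \<ge> 0"
  proof (rule ccontr)
    assume "\<not> v \<ge> 0"
    define s where "s = min (\<alpha> - 1) ((c - u * (\<alpha> - 1)) / v - 1)"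
    have "v * s \<ge> v * ((c - u * (\<alpha> - 1)) / v - 1)"
      using \<open>\<not> v \<ge> 0\<close> by (intro mult_left_mono_neg) (auto simp: s_def)
    moreover have "v * ((c - u * (\<alpha> - 1)) / v - 1) = c - u * (\<alpha> - 1) - v"
    proof -
      have "v * (d / v - 1) = d - v" for d using \<open>\<not> v \<ge> 0\<close> by (simp add: field_simps)
      then show ?thesis .
    qed
    ultimately have "v * s + u * (\<alpha> - 1) > c" using \<open>\<not> v \<ge> 0\<close> by linarith
    moreover have "s < \<alpha>" by (simp add: s_def min_def)
    ultimately show False using T'[of "\<alpha> - 1" s] by auto
  qed
  have pos: "u + v > 0" using u v p uv by (auto simp: zero_prod_def)
  have c: "(u + v) * \<alpha> \<le> c"
  proof (rule field_le_epsilon)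
    fix e :: real assume "e > 0"
    have "u * (\<alpha> - e / (u + v)) + v * (\<alpha> - e / (u + v)) \<le> c"
      using pos \<open>e > 0\<close> by (intro T') auto
    moreover have "u * (\<alpha> - e / (u + v)) + v * (\<alpha> - e / (u + v)) = (u + v) * \<alpha> - e"
      using pos by (simp flip: distrib_right) (simp add: right_diff_distrib)
    ultimately show "(u + v) * \<alpha> \<le> c + e" by linarith
  qed
  have "\<alpha> \<le> u / (u + v) * h x + (1 - u / (u + v)) * g x" if "x \<in> X" for x
  proof -
    have "(h x, g x) \<in> S" using that by (auto simp: S_def)
    then have "(u + v) * \<alpha> \<le> u * h x + v * g x" using S c by (force simp: uv)
    then have "\<alpha> \<le> (u * h x + v * g x) / (u + v)" using pos by (simp add: field_simps)
    also have "\<dots> = u / (u + v) * h x + v / (u + v) * g x"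
      by (simp add: add_divide_distrib)
    also have "v / (u + v) = 1 - u / (u + v)"
      using pos by (simp add: field_simps)
    finally show ?thesis .
  qed
  then show ?thesis using u v pos by (intro bexI[of _ "u / (u + v)"]) auto
qed

text \<open>
  Removing one point \<open>z\<close> of \<open>S\<close> leaves the alternatives valid on the convex set where
  \<open>F x z < \<alpha>\<close>. The point that the induction gives there and \<open>z\<close> itself are two alternatives on all
  of \<open>X\<close>, and concavity in the second argument merges them into one point. The set \<open>X\<close> has to
  vary in the induction for this reason.
\<close>

lemma finite_alternatives_one_point:
  fixes F :: "'a::real_vector \<Rightarrow> 'b::real_vector \<Rightarrow> real"
  assumes fin: "finite S" and S: "S \<subseteq> Y" and ne: "Y \<noteq> {}"
    and conv: "\<And>y. y \<in> Y \<Longrightarrow> convex_on X (\<lambda>x. F x y)"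
    and conc: "\<And>x. x \<in> X \<Longrightarrow> concave_on Y (F x)"
    and alt: "\<And>x. x \<in> X \<Longrightarrow> \<exists>y\<in>S. \<alpha> \<le> F x y"
  shows "\<exists>y\<in>Y. \<forall>x\<in>X. \<alpha> \<le> F x y"
  using fin S conv conc alt
proof (induction S arbitrary: X)
  case empty
  then have "X = {}" by (metis all_not_in_conv)
  moreover obtain y where "y \<in> Y" using ne by blast
  ultimately show ?case by auto
next
  case (insert z S)
  show ?case
  proof (cases "X = {}")
    case True
    obtain y where "y \<in> Y" using ne by blast
    with True show ?thesis by auto
  next
    case False
    have z: "z \<in> Y" using insert.prems by auto
    define X' where "X' = {x \<in> X. F x z < \<alpha>}"
    have cX': "convex X'"
    proof (rule convexI)
      fix x x' and s t :: real
      assume x: "x \<in> X'" "x' \<in> X'" and st: "0 \<le> s" "0 \<le> t" "s + t = 1"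
      have le: "F (s *\<^sub>R x + t *\<^sub>R x') z \<le> s * F x z + t * F x' z"
        "s *\<^sub>R x + t *\<^sub>R x' \<in> X"
        using insert.prems(2)[OF z] x st by (auto simp: convex_on_def convex_def X'_def)
      have "s * F x z + t * F x' z < \<alpha>"
        using convex_bound_lt[of "F x z" \<alpha> "F x' z" s t] x st by (auto simp: X'_def)
      then show "s *\<^sub>R x + t *\<^sub>R x' \<in> X'" using le by (auto simp: X'_def)
    qed
    have "\<exists>y\<in>Y. \<forall>x\<in>X'. \<alpha> \<le> F x y"
    proof (rule insert.IH)
      show "S \<subseteq> Y" using insert.prems by auto
      show "convex_on X' (\<lambda>x. F x y)" if "y \<in> Y" for y
        by (rule convex_on_subset[OF insert.prems(2)[OF that] _ cX']) (auto simp: X'_def)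
      show "concave_on Y (F x)" if "x \<in> X'" for x
        using that insert.prems(3) by (auto simp: X'_def)
      show "\<exists>y\<in>S. \<alpha> \<le> F x y" if "x \<in> X'" for x
        using that insert.prems(4)[of x] by (auto simp: X'_def)
    qed
    then obtain y where y: "y \<in> Y" "\<And>x. x \<in> X' \<Longrightarrow> \<alpha> \<le> F x y" by auto
    have "\<exists>\<theta>\<in>{0..1}. \<forall>x\<in>X. \<alpha> \<le> \<theta> * F x y + (1 - \<theta>) * F x z"
    proof (rule convex_combination_of_two_alternatives)
      show "\<alpha> \<le> F x y \<or> \<alpha> \<le> F x z" if "x \<in> X" for x
        using y(2)[of x] that by (cases "F x z < \<alpha>") (auto simp: X'_def)
    qed (rule insert.prems(2)[OF y(1)] insert.prems(2)[OF z])+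
    then obtain \<theta> where \<theta>: "\<theta> \<in> {0..1}" "\<And>x. x \<in> X \<Longrightarrow> \<alpha> \<le> \<theta> * F x y + (1 - \<theta>) * F x z"
      by auto
    have "\<alpha> \<le> F x (\<theta> *\<^sub>R y + (1 - \<theta>) *\<^sub>R z)" if "x \<in> X" for x
    proof -
      have "\<theta> * F x y + (1 - \<theta>) * F x z \<le> F x (\<theta> *\<^sub>R y + (1 - \<theta>) *\<^sub>R z)"
        using insert.prems(3)[OF that] \<theta>(1) y z by (auto simp: concave_on_iff)
      then show ?thesis using \<theta>(2)[OF that] by linarith
    qed
    moreover have "\<theta> *\<^sub>R y + (1 - \<theta>) *\<^sub>R z \<in> Y"
    proof -
      obtain x where "x \<in> X" using False by blast
      then have "convex Y" using insert.prems(3)[of x] by (simp add: concave_on_iff)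
      then show ?thesis using y z \<theta>(1) by (simp add: convex_def)
    qed
    ultimately show ?thesis by blast
  qed
qed

text \<open>
  The finite intersection property for the sublevel sets, separated from the convexity argument.
\<close>

lemma compact_sublevels_common_point:
  fixes F :: "'a::euclidean_space \<Rightarrow> 'b::real_vector \<Rightarrow> real"
  assumes ne: "Y \<noteq> {}"
    and comp: "\<And>y. y \<in> Y \<Longrightarrow> compact {x \<in> X. F x y \<le> \<beta>}"
    and fip: "\<And>S. finite S \<Longrightarrow> S \<subseteq> Y \<Longrightarrow> \<exists>x\<in>X. \<forall>y\<in>S. F x y \<le> \<beta>"
  shows "\<exists>x\<in>X. \<forall>y\<in>Y. F x y \<le> \<beta>"
proof -
  define A where "A y = {x \<in> X. F x y \<le> \<beta>}" for y
  obtain y0 where y0: "y0 \<in> Y" using ne by blast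
  have "A y0 \<inter> (\<Inter>y\<in>Y. A y) \<noteq> {}"
  proof (rule compact_imp_fip_image)
    show "compact (A y0)" using comp[OF y0] by (simp add: A_def)
    show "closed (A y)" if "y \<in> Y" for y using comp[OF that] by (simp add: A_def compact_imp_closed)
    fix S assume S: "finite S" "S \<subseteq> Y"
    obtain x where "x \<in> X" "\<forall>y\<in>insert y0 S. F x y \<le> \<beta>"
      using fip[of "insert y0 S"] S y0 by auto
    then have "x \<in> A y0 \<inter> (\<Inter>y\<in>S. A y)" by (simp add: A_def)
    then show "A y0 \<inter> (\<Inter>y\<in>S. A y) \<noteq> {}" by blast
  qed
  then obtain x where "x \<in> A y0 \<inter> (\<Inter>y\<in>Y. A y)" by blast
  then have "x \<in> X" "\<forall>y\<in>Y. F x y \<le> \<beta>" by (simp_all add: A_def)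
  then show ?thesis by (rule bexI[rotated])
qed

text \<open>
  The nontrivial half of the minimax theorem: if \<open>inf\<^sub>x F x y < \<beta>\<close> for all \<open>y\<close>, then
  \<open>inf\<^sub>x sup\<^sub>y F x y \<le> \<beta>\<close>. If finitely many sublevel sets had no common point, the previous lemmas
  would give a single \<open>y\<close> with \<open>F x y \<ge> \<beta>\<close> for all \<open>x\<close>.
\<close>

lemma minimax_point:
  fixes F :: "'a::euclidean_space \<Rightarrow> 'b::real_vector \<Rightarrow> real"
  assumes ne: "Y \<noteq> {}"
    and conv: "\<And>y. y \<in> Y \<Longrightarrow> convex_on X (\<lambda>x. F x y)"
    and conc: "\<And>x. x \<in> X \<Longrightarrow> concave_on Y (F x)"
    and comp: "\<And>y. y \<in> Y \<Longrightarrow> compact {x \<in> X. F x y \<le> \<beta>}"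
    and below: "\<And>y. y \<in> Y \<Longrightarrow> \<exists>x\<in>X. F x y < \<beta>"
  shows "\<exists>x\<in>X. \<forall>y\<in>Y. F x y \<le> \<beta>"
proof (rule compact_sublevels_common_point[OF ne comp])
  fix S assume S: "finite S" "S \<subseteq> Y"
  show "\<exists>x\<in>X. \<forall>y\<in>S. F x y \<le> \<beta>"
  proof (rule ccontr)
    assume *: "\<not> (\<exists>x\<in>X. \<forall>y\<in>S. F x y \<le> \<beta>)"
    have alt: "\<exists>y\<in>S. \<beta> \<le> F x y" if "x \<in> X" for x
      using * that by (meson le_cases)
    have "\<exists>y\<in>Y. \<forall>x\<in>X. \<beta> \<le> F x y"
      using finite_alternatives_one_point[where F = F and X = X and Y = Y, OF S ne conv conc alt] .
    then obtain y where y: "y \<in> Y" "\<forall>x\<in>X. \<beta> \<le> F x y" by (elim bexE)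
    obtain x where "x \<in> X" "F x y < \<beta>" using below[OF y(1)] by (elim bexE)
    with y(2) show False by (simp add: leD)
  qed
qed

text \<open>
  On the segment from \<open>0\<close> to a far point \<open>v\<close>, consider the point at distance \<open>1\<close> from \<open>0\<close>. Strong
  convexity pushes its value down by an amount linear in the length of \<open>v\<close>, while continuity bounds
  it from below on the unit ball.
\<close>

lemma strongly_convex_sublevel_bounded:
  fixes g :: "'a::euclidean_space \<Rightarrow> real"
  assumes sc: "strongly_convex_on norm m UNIV g" and m: "m > 0" and cont: "continuous_on UNIV g"
  shows "bounded {v. g v \<le> \<alpha>}"
proof -
  have "compact (g ` cball 0 1)"
    by (intro compact_continuous_image continuous_on_subset[OF cont]) auto
  then have "bdd_below (g ` cball 0 1)" by (simp add: bounded_imp_bdd_below compact_imp_bounded)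
  then obtain B where B: "\<And>z. norm z \<le> 1 \<Longrightarrow> B \<le> g z" unfolding bdd_below_def by force
  define A where "A = max \<alpha> (g 0)"
  define R where "R = max 1 (1 + 2 / m * (A - B))"
  have "norm v \<le> R" if v: "g v \<le> \<alpha>" for v
  proof (cases "norm v \<le> 1")
    case False
    define t where "t = 1 / norm v"
    have "0 < norm v" using False by linarith
    then have t: "0 < t" "t \<le> 1" "t * norm v = 1" using False by (auto simp: t_def field_simps)
    have "g (t *\<^sub>R v + (1 - t) *\<^sub>R 0) \<le> t * g v + (1 - t) * g 0 - m / 2 * t * (1 - t) * (norm (v - 0))\<^sup>2"
      using sc t unfolding strongly_convex_on_def by (meson UNIV_I atLeastAtMost_iff less_imp_le)
    also have "t * g v + (1 - t) * g 0 \<le> t * A + (1 - t) * A"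
      using t v by (intro add_mono mult_left_mono) (auto simp: A_def)
    also have "m / 2 * t * (1 - t) * (norm (v - 0))\<^sup>2 = m / 2 * ((t * norm v) * (norm v - t * norm v))"
      by (simp add: power2_eq_square right_diff_distrib left_diff_distrib mult_ac)
    also have "\<dots> = m / 2 * (norm v - 1)"
      by (simp add: t(3))
    finally have "g (t *\<^sub>R v) \<le> A - m / 2 * (norm v - 1)" by (simp add: algebra_simps)
    moreover have "B \<le> g (t *\<^sub>R v)" using t by (intro B) auto
    ultimately have "m / 2 * (norm v - 1) \<le> A - B" by linarith
    then have "norm v \<le> 1 + 2 / m * (A - B)" using m by (simp add: field_simps)
    then show ?thesis by (simp add: R_def)
  qed (simp add: R_def)
  then show ?thesis by (auto simp: bounded_iff)
qed

lemma attains_max_if_superlevel_bounded: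
  fixes h g :: "'a::euclidean_space \<Rightarrow> real"
  assumes S: "closed S" "S \<noteq> {}" and h: "continuous_on S h"
    and le: "\<And>v. v \<in> S \<Longrightarrow> h v \<le> g v + c"
    and bdd: "\<And>\<alpha>. bounded {v \<in> S. \<alpha> \<le> g v}"
  shows "\<exists>p\<in>S. \<forall>v\<in>S. h v \<le> h p"
proof -
  obtain v0 where v0: "v0 \<in> S" using S by auto
  define T where "T = {v \<in> S. h v0 \<le> h v}"
  have "T \<subseteq> {v \<in> S. h v0 - c \<le> g v}" using le by (force simp: T_def)
  then have "bounded T" using bdd bounded_subset by blast
  moreover have "closed T"
  proof -
    have "T = S \<inter> h -` {h v0..}" by (auto simp: T_def)
    then show ?thesis using continuous_closed_preimage[OF h S(1)] by auto
  qed
  ultimately have "compact T" by (simp add: compact_eq_bounded_closed)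
  moreover have "v0 \<in> T" using v0 by (simp add: T_def)
  moreover have "continuous_on T h" by (rule continuous_on_subset[OF h]) (auto simp: T_def)
  ultimately obtain p where p: "p \<in> T" "\<And>v. v \<in> T \<Longrightarrow> h v \<le> h p"
    using continuous_attains_sup[of T h] by blast
  have "h v \<le> h p" if "v \<in> S" for v
  proof (cases "v \<in> T")
    case False
    then have "h v < h v0" using that by (simp add: T_def)
    then show ?thesis using p(2)[OF \<open>v0 \<in> T\<close>] by simp
  qed (use p in auto)
  then show ?thesis using p(1) by (auto simp: T_def)
qed


section \<open>Gradients and Bregman divergences\<close>

lemma GDERIV_exists:
  fixes g :: "'a::euclidean_space \<Rightarrow> real"
  assumes "g differentiable (at u)"
  shows "\<exists>D. GDERIV g u :> D"
proof -
  obtain g' where g': "(g has_derivative g') (at u)" using assms by (auto simp: differentiable_def)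
  interpret linear g' using g' by (rule has_derivative_linear)
  have "g' h = h \<bullet> (\<Sum>b\<in>Basis. g' b *\<^sub>R b)" for h
  proof -
    have "g' h = g' (\<Sum>b\<in>Basis. (h \<bullet> b) *\<^sub>R b)" by (simp add: euclidean_representation)
    also have "\<dots> = (\<Sum>b\<in>Basis. (h \<bullet> b) * g' b)" by (simp add: sum scale)
    finally show ?thesis by (simp add: inner_sum_right mult.commute)
  qed
  then have "g' = (\<lambda>h. h \<bullet> (\<Sum>b\<in>Basis. g' b *\<^sub>R b))" by blast
  then have "GDERIV g u :> (\<Sum>b\<in>Basis. g' b *\<^sub>R b)" using g' unfolding gderiv_def by metis
  then show ?thesis by blast
qed

lemma GDERIV_unique:
  fixes D E :: "'a::real_inner"
  assumes "GDERIV g u :> D" "GDERIV g u :> E" shows "D = E"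
proof -
  have "(\<lambda>h. h \<bullet> D) = (\<lambda>h. h \<bullet> E)"
    using assms by (simp add: gderiv_def has_derivative_unique)
  then have "(D - E) \<bullet> D = (D - E) \<bullet> E" by meson
  then have "(D - E) \<bullet> (D - E) = 0" by (simp add: inner_diff_right)
  then show ?thesis by simp
qed

lemma GDERIV_gradient:
  fixes g :: "'a::euclidean_space \<Rightarrow> real"
  assumes "g differentiable (at u)"
  shows "GDERIV g u :> gradient g u"
    unfolding gradient_def using GDERIV_exists[OF assms] by (metis GDERIV_unique theI)

lemma directional_derivative_gradient:
  fixes g :: "'a::euclidean_space \<Rightarrow> real"
  assumes "g differentiable (at u)"
  shows "((\<lambda>t. (g (u + t *\<^sub>R d) - g u) / t) \<longlongrightarrow> gradient g u \<bullet> d) (at 0)"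
proof -
  have "(g has_derivative (\<lambda>h. h \<bullet> gradient g u)) (at (u + 0 *\<^sub>R d))"
    using GDERIV_gradient[OF assms] by (simp add: gderiv_def)
  moreover have "((\<lambda>t. u + t *\<^sub>R d) has_derivative (\<lambda>t. t *\<^sub>R d)) (at (0::real))"
    by (auto intro!: derivative_eq_intros)
  ultimately have "((\<lambda>t. g (u + t *\<^sub>R d)) has_derivative (\<lambda>t. (t *\<^sub>R d) \<bullet> gradient g u)) (at 0)"
    using has_derivative_compose by blast
  then have "((\<lambda>t. g (u + t *\<^sub>R d)) has_field_derivative (gradient g u \<bullet> d)) (at 0)"
    by (rule has_derivative_imp_has_field_derivative) (simp add: inner_commute)
  then show ?thesis by (simp add: DERIV_def)
qed

text \<open>
  First-order consequences of convexity (\<open>b = 0\<close>) and of strong convexity (\<open>b\<close> a multiple of a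
  squared distance) are both this limit of difference quotients.
\<close>

lemma directional_derivative_limit_le:
  fixes g :: "'a::euclidean_space \<Rightarrow> real"
  assumes diff: "g differentiable (at u)"
    and le: "\<And>t. 0 < t \<Longrightarrow> t \<le> 1 \<Longrightarrow> g (u + t *\<^sub>R d) - g u \<le> t * (a - (1 - t) * b)"
  shows "gradient g u \<bullet> d \<le> a - b"
proof (rule tendsto_le)
  show "((\<lambda>t. (g (u + t *\<^sub>R d) - g u) / t) \<longlongrightarrow> gradient g u \<bullet> d) (at_right 0)"
    by (rule tendsto_mono[OF _ directional_derivative_gradient[OF diff]]) (simp add: at_le)
  have "((\<lambda>t::real. a - (1 - t) * b) \<longlongrightarrow> a - (1 - 0) * b) (at_right 0)"
    by (intro tendsto_intros)
  then show "((\<lambda>t::real. a - (1 - t) * b) \<longlongrightarrow> a - b) (at_right 0)" by simp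
  have "eventually (\<lambda>t::real. t \<in> {0<..<1}) (at_right 0)"
    by (rule eventually_at_right_real) simp
  then show "\<forall>\<^sub>F t in at_right 0. (g (u + t *\<^sub>R d) - g u) / t \<le> a - (1 - t) * b"
  proof eventually_elim
    case (elim t)
    then show ?case using le[of t] by (simp add: pos_divide_le_eq mult.commute)
  qed
qed simp

context dgf_setup
begin

lemma bregman_nonneg:
  assumes u: "u \<in> interior P" and v: "v \<in> P"
  shows "0 \<le> bregman r u v"
proof -
  have "gradient r u \<bullet> (v - u) \<le> (r v - r u) - 0"
  proof (rule directional_derivative_limit_le[OF differentiable_r[OF u]])
    fix t :: real assume t: "0 < t" "t \<le> 1"
    have "r (u + t *\<^sub>R (v - u)) \<le> (1 - t) * r u + t * r v"
      using convex_onD[OF convex_r, of t u v] t v u interior_subset[of P]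
      by (auto simp: algebra_simps)
    then show "r (u + t *\<^sub>R (v - u)) - r u \<le> t * (r v - r u - (1 - t) * 0)"
      by (simp add: algebra_simps)
  qed
  then show ?thesis by (simp add: bregman_def)
qed

lemma bregman_strongly_convex:
  assumes u: "u \<in> U \<inter> interior P" and v: "v \<in> U \<inter> interior P"
  shows "\<mu> / 2 * (N (v - u))\<^sup>2 \<le> bregman r u v"
proof -
  have "gradient r u \<bullet> (v - u) \<le> (r v - r u) - \<mu> / 2 * (N (v - u))\<^sup>2"
  proof (rule directional_derivative_limit_le)
    show "r differentiable at u" using u differentiable_r by auto
    fix t :: real assume t: "0 < t" "t \<le> 1"
    have "r (t *\<^sub>R v + (1 - t) *\<^sub>R u) \<le> t * r v + (1 - t) * r u - \<mu> / 2 * t * (1 - t) * (N (v - u))\<^sup>2"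
      using strongly_convex_r u v t unfolding strongly_convex_on_def
      by (meson atLeastAtMost_iff less_imp_le)
    also have "t *\<^sub>R v + (1 - t) *\<^sub>R u = u + t *\<^sub>R (v - u)" by (simp add: algebra_simps)
    finally show "r (u + t *\<^sub>R (v - u)) - r u \<le> t * (r v - r u - (1 - t) * (\<mu> / 2 * (N (v - u))\<^sup>2))"
      by (simp add: algebra_simps)
  qed
  then show ?thesis by (simp add: bregman_def)
qed

lemma bregman_eq_0_imp_eq:
  assumes u: "u \<in> U \<inter> interior P" and v: "v \<in> U \<inter> interior P" and le: "bregman r u v \<le> 0"
  shows "v = u"
proof -
  have "\<mu> / 2 * (N (v - u))\<^sup>2 \<le> 0" using bregman_strongly_convex[OF u v] le by linarith
  then have "N (v - u) = 0" using \<mu>_pos by (simp add: mult_le_0_iff)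
  then show ?thesis using norm_N by (auto simp: is_norm_def)
qed

text \<open>
  If \<open>U\<close> reaches the boundary of \<open>P\<close>, the gradient blows up along the segment from an interior point
  \<open>w\<close> of \<open>C\<close> to a boundary minimizer \<open>p\<close>. Convexity of \<open>r\<close> on a ball around \<open>w\<close> makes the slope towards \<open>w\<close> at least
  as negative as a multiple of the gradient norm, whereas minimality bounds this slope from below,
  because the convex function \<open>l\<close> grows at most linearly along the segment.
\<close>

lemma minimizer_in_interior:
  assumes C: "C \<subseteq> U" and l: "convex_on C l" and c: "c > 0"
    and meets: "C \<inter> interior P \<noteq> {}"
    and p: "p \<in> C" and min: "\<And>v. v \<in> C \<Longrightarrow> l p + c * r p \<le> l v + c * r v"
  shows "p \<in> interior P"
proof (rule ccontr)
  assume np: "p \<notin> interior P"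
  have pP: "p \<in> P" using p C U_subset_P by auto
  have "p \<in> frontier P" using np pP by (simp add: frontier_def closure_closed[OF closed_P])
  moreover have "\<not> U \<subseteq> interior P" using np p C by auto
  ultimately have blow: "filterlim (\<lambda>u. norm (gradient r u)) at_top (at p within interior P)"
    using boundary by auto
  obtain w where w: "w \<in> C" "w \<in> interior P" using meets by auto
  define z where "z t = p + t *\<^sub>R (w - p)" for t :: real
  have z: "z t \<in> interior P" if "0 < t" "t \<le> 1" for t
    using mem_interior_convex_shrink[OF convex_P w(2) pP that] by (simp add: z_def algebra_simps)
  have zC: "z t \<in> C" if "0 < t" "t \<le> 1" for t
  proof -
    have "(1 - t) *\<^sub>R p + t *\<^sub>R w \<in> C" using l that p w(1) by (auto simp: convex_on_def convex_def)
    then show ?thesis by (simp add: z_def algebra_simps)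
  qed
  have ev: "eventually (\<lambda>t::real. t \<in> {0<..<1}) (at_right 0)"
    by (rule eventually_at_right_real) simp
  have "filterlim z (at p within interior P) (at_right 0)"
    unfolding filterlim_at
  proof
    show "\<forall>\<^sub>F t in at_right 0. z t \<in> interior P \<and> z t \<noteq> p"
      using ev by eventually_elim (use z np in fastforce)
    have "(z \<longlongrightarrow> p + 0 *\<^sub>R (w - p)) (at_right 0)" unfolding z_def by (intro tendsto_intros)
    then show "(z \<longlongrightarrow> p) (at_right 0)" by simp
  qed
  then have lim: "filterlim (\<lambda>t. norm (gradient r (z t))) at_top (at_right 0)"
    by (rule filterlim_compose[OF blow])
  obtain \<delta> where \<delta>: "\<delta> > 0" "cball w \<delta> \<subseteq> interior P"
    using w(2) open_contains_cball[of "interior P"] by auto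
  have "compact (r ` cball w \<delta>)"
    using \<delta>(2) interior_subset[of P]
    by (intro compact_continuous_image continuous_on_subset[OF continuous_r]) auto
  then have "bdd_above (r ` cball w \<delta>)" by (simp add: bounded_imp_bdd_above compact_imp_bounded)
  then obtain B where B: "\<And>v. v \<in> cball w \<delta> \<Longrightarrow> r v \<le> B" unfolding bdd_above_def by blast
  define A where "A = l w - l p"
  have key: "\<delta> * norm (gradient r (z t)) \<le> B - r p + A / c" if t: "0 < t" "t < 1" for t
  proof -
    define G where "G = gradient r (z t)"
    \<comment> \<open>The subgradient inequality at the ball point in the direction of the gradient
      turns the gradient norm into a bound on function values.\<close>
    define v where "v = w + \<delta> *\<^sub>R sgn G"
    have zi: "z t \<in> interior P" using z t by simp
    have v: "v \<in> cball w \<delta>" using \<delta>(1) by (simp add: v_def dist_norm norm_sgn)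
    then have vP: "v \<in> P" using \<delta>(2) interior_subset by blast
    have "0 \<le> r v - r (z t) - G \<bullet> (v - z t)"
      using bregman_nonneg[OF zi vP] by (simp add: bregman_def G_def)
    moreover have "v - z t = \<delta> *\<^sub>R sgn G + (1 - t) *\<^sub>R (w - p)"
      by (simp add: v_def z_def algebra_simps)
    moreover have "G \<bullet> sgn G = norm G"
      by (cases "G = 0") (simp_all add: sgn_div_norm dot_square_norm power2_eq_square)
    ultimately have 1: "\<delta> * norm G + (1 - t) * (G \<bullet> (w - p)) \<le> B - r (z t)"
      using B[OF v] by (simp add: inner_add_right)
    have "0 \<le> r p - r (z t) - G \<bullet> (p - z t)"
      using bregman_nonneg[OF zi pP] by (simp add: bregman_def G_def)
    moreover have "p - z t = (- t) *\<^sub>R (w - p)" by (simp add: z_def)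
    ultimately have 2: "r (z t) - r p \<le> t * (G \<bullet> (w - p))" by simp
    have "l (z t) \<le> (1 - t) * l p + t * l w"
      using convex_onD[OF l, of t p w] t p w by (simp add: z_def algebra_simps)
    then have "l (z t) - l p \<le> t * A" by (simp add: A_def algebra_simps)
    moreover have "l p + c * r p \<le> l (z t) + c * r (z t)" using min zC t by simp
    ultimately have "c * (r p - r (z t)) \<le> t * A" by (simp add: algebra_simps)
    then have 3: "r p - r (z t) \<le> t * (A / c)" using c by (simp add: field_simps)
    then have "t * (A / c) \<ge> t * (- (G \<bullet> (w - p)))" using 2 by simp
    then have 4: "- (G \<bullet> (w - p)) \<le> A / c" using t mult_le_cancel_left_pos by blast
    have "(1 - t) * (- (G \<bullet> (w - p))) \<le> (1 - t) * (A / c)" using 4 t by (intro mult_left_mono) auto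
    then have "\<delta> * norm G \<le> B - r p + t * (A / c) + (1 - t) * (A / c)" using 1 3 by linarith
    also have "\<dots> = B - r p + A / c"
    proof -
      have "t * d + (1 - t) * d = d" for d by (simp add: algebra_simps)
      then show ?thesis by (simp only: add.assoc)
    qed
    finally show ?thesis by (simp add: G_def)
  qed
  have "eventually (\<lambda>t. (B - r p + A / c) / \<delta> < norm (gradient r (z t))) (at_right 0)"
    using lim by (simp add: filterlim_at_top_dense)
  with ev have "eventually (\<lambda>t::real. False) (at_right 0)"
  proof eventually_elim
    case (elim t)
    then show ?case using key[of t] \<delta>(1) by (simp add: field_simps)
  qed
  then show False by simp
qed

text \<open>
  The difference quotients of \<open>r\<close> along the segment from \<open>p\<close> to \<open>v\<close> converge; those of \<open>l\<close> are
  replaced by the chord inequality, so that \<open>l\<close> can be a function with kinks, such as the negative of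
  the dual objective.
\<close>

lemma minimizer_variational:
  assumes l: "convex_on C l" and c: "c > 0" and pi: "p \<in> interior P"
    and p: "p \<in> C" and min: "\<And>v. v \<in> C \<Longrightarrow> l p + c * r p \<le> l v + c * r v"
    and v: "v \<in> C"
  shows "l p - l v \<le> c * (gradient r p \<bullet> (v - p))"
proof -
  have "- (gradient r p \<bullet> (v - p)) \<le> (l v - l p) / c"
  proof (rule tendsto_le)
    show "((\<lambda>t. - ((r (p + t *\<^sub>R (v - p)) - r p) / t)) \<longlongrightarrow> - (gradient r p \<bullet> (v - p))) (at_right 0)"
      by (rule tendsto_minus,
          rule tendsto_mono[OF _ directional_derivative_gradient[OF differentiable_r[OF pi]]])
        (simp add: at_le)
    have "eventually (\<lambda>t::real. t \<in> {0<..<1}) (at_right 0)"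
      by (rule eventually_at_right_real) simp
    then show "\<forall>\<^sub>F t in at_right 0. - ((r (p + t *\<^sub>R (v - p)) - r p) / t) \<le> (l v - l p) / c"
    proof eventually_elim
      case (elim t)
      define z where "z = p + t *\<^sub>R (v - p)"
      have z: "z = (1 - t) *\<^sub>R p + t *\<^sub>R v" by (simp add: z_def algebra_simps)
      have "z \<in> C" using l elim p v unfolding z by (auto simp: convex_on_def convex_def)
      then have 1: "l p + c * r p \<le> l z + c * r z" by (rule min)
      have "l z \<le> (1 - t) * l p + t * l v"
        unfolding z using convex_onD[OF l, of t p v] elim p v by simp
      then have "- (c * (r z - r p)) \<le> t * (l v - l p)" using 1 by (simp add: algebra_simps)
      then show ?case using elim c unfolding z_def[symmetric] by (simp add: field_simps)
    qed
  qed simp_all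
  then show ?thesis using c by (simp add: field_simps)
qed

text \<open>
  Absorbing the linear part of \<open>V(q, \<cdot>)\<close> into \<open>l\<close> reduces the problem to the minimization of a
  convex function plus a multiple of \<open>r\<close>. The variational inequality is then the three-point
  inequality (second claim), which gives uniqueness by strong convexity once a second minimizer is
  also known to be interior.
\<close>

lemma bregman_proximal_point:
  assumes C: "C \<subseteq> U" and l: "convex_on C l" and c: "c > 0" and q: "q \<in> interior P"
    and meets: "C \<inter> interior P \<noteq> {}"
    and p: "p \<in> C" and min: "\<And>v. v \<in> C \<Longrightarrow> l p + c * bregman r q p \<le> l v + c * bregman r q v"
  shows "p \<in> interior P"
    and "\<And>v. v \<in> C \<Longrightarrow> l p + c * bregman r q p + c * bregman r p v \<le> l v + c * bregman r q v"
    and "\<And>v. v \<in> C \<Longrightarrow> l v + c * bregman r q v = l p + c * bregman r q p \<Longrightarrow> v = p"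
proof -
  define h where "h v = l v - c * (gradient r q \<bullet> v)" for v
  have eq: "h v + c * r v = l v + c * bregman r q v + c * (r q - gradient r q \<bullet> q)" for v
    by (simp add: h_def bregman_def algebra_simps)
  have h: "convex_on C h"
    using l by (simp add: convex_on_def h_def algebra_simps)
  have hmin: "h p + c * r p \<le> h v + c * r v" if "v \<in> C" for v
    unfolding eq using min[OF that] by simp
  show pi: "p \<in> interior P" by (rule minimizer_in_interior[OF C h c meets p hmin])
  show growth: "l p + c * bregman r q p + c * bregman r p v \<le> l v + c * bregman r q v" if "v \<in> C" for v
  proof -
    have "h p - h v \<le> c * (gradient r p \<bullet> (v - p))"
      by (rule minimizer_variational[OF h c pi p hmin that])
    then show ?thesis
      by (simp add: h_def bregman_def algebra_simps)
  qed
  show "v = p" if v: "v \<in> C" "l v + c * bregman r q v = l p + c * bregman r q p" for v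
  proof -
    have "l v + c * bregman r q v \<le> l v' + c * bregman r q v'" if "v' \<in> C" for v'
      using min[OF that] v(2) by simp
    then have "h v + c * r v \<le> h v' + c * r v'" if "v' \<in> C" for v'
      unfolding eq using that by simp
    then have vi: "v \<in> interior P" by (rule minimizer_in_interior[OF C h c meets v(1)])
    have "c * bregman r p v \<le> 0" using growth[OF v(1)] v(2) by simp
    then have "bregman r p v \<le> 0" using c by (simp add: mult_le_0_iff)
    then show ?thesis by (rule bregman_eq_0_imp_eq[rotated 2]) (use p v C pi vi in auto)
  qed
qed

text \<open>
  As a function of its second argument a sum of divergences is a multiple of \<open>r\<close>, a linear term and a
  constant.
\<close>

lemma weighted_bregman_sum:
  "(\<Sum>j\<in>J. a j * bregman r (y j) v)
     = (\<Sum>j\<in>J. a j) * r v - (\<Sum>j\<in>J. a j *\<^sub>R gradient r (y j)) \<bullet> v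
       + (\<Sum>j\<in>J. a j * (gradient r (y j) \<bullet> y j - r (y j)))"
  by (simp add: bregman_def inner_diff_right inner_sum_left sum_distrib_right sum_subtractf
      sum.distrib right_diff_distrib)

text \<open>
  The first-order condition at the minimizer says that \<open>(\<Sum>j\<in>J. a j *\<^sub>R gradient r (y j)) - c *\<^sub>R gradient r q\<close>
  is normal to \<open>U\<close>, which is how the hypothesis on normal vectors enters.
\<close>

lemma weighted_bregman_minimizer:
  assumes c: "c = (\<Sum>j\<in>J. a j)" "c > 0"
    and q: "q \<in> U"
    and min: "\<And>v. v \<in> U \<Longrightarrow> (\<Sum>j\<in>J. a j * bregman r (y j) q) \<le> (\<Sum>j\<in>J. a j * bregman r (y j) v)"
  shows "q \<in> interior P"
    and "(\<Sum>j\<in>J. a j *\<^sub>R gradient r (y j)) - c *\<^sub>R gradient r q \<in> subdifferential (convex_indicator U) q"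
    and "\<And>v. v \<in> U \<Longrightarrow> (\<Sum>j\<in>J. a j * bregman r (y j) v) = (\<Sum>j\<in>J. a j * bregman r (y j) q) \<Longrightarrow> v = q"
proof -
  define s where "s = (\<Sum>j\<in>J. a j *\<^sub>R gradient r (y j))"
  define h where "h v = - (s \<bullet> v)" for v
  define d where "d = (\<Sum>j\<in>J. a j * (gradient r (y j) \<bullet> y j - r (y j)))"
  have eq: "(\<Sum>j\<in>J. a j * bregman r (y j) v) = h v + c * r v + d" for v
    by (simp add: weighted_bregman_sum c h_def s_def d_def)
  have h: "convex_on U h" using convex_U by (simp add: convex_on_def h_def inner_add_right)
  have hmin: "h q + c * r q \<le> h v + c * r v" if "v \<in> U" for v
    using min[OF that] unfolding eq by simp
  show qi: "q \<in> interior P"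
    by (rule minimizer_in_interior[OF order_refl h c(2) U_meets_interior q hmin])
  have var: "h q - h v \<le> c * (gradient r q \<bullet> (v - q))" if "v \<in> U" for v
    by (rule minimizer_variational[OF h c(2) qi q hmin that])
  then have le: "(s - c *\<^sub>R gradient r q) \<bullet> (v - q) \<le> 0" if "v \<in> U" for v
    using var[OF that] by (simp add: h_def inner_diff_left inner_diff_right right_diff_distrib)
  show "(\<Sum>j\<in>J. a j *\<^sub>R gradient r (y j)) - c *\<^sub>R gradient r q \<in> subdifferential (convex_indicator U) q"
    unfolding s_def[symmetric] subdifferential_def convex_indicator_def
    using le q by (auto simp: zero_ereal_def)
  show "v = q" if v: "v \<in> U" "(\<Sum>j\<in>J. a j * bregman r (y j) v) = (\<Sum>j\<in>J. a j * bregman r (y j) q)" for v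
  proof -
    have hv: "h v + c * r v = h q + c * r q" using v(2) unfolding eq by simp
    have "h v + c * r v \<le> h v' + c * r v'" if "v' \<in> U" for v' using hmin[OF that] hv by simp
    then have vi: "v \<in> interior P"
      by (rule minimizer_in_interior[OF order_refl h c(2) U_meets_interior v(1)])
    have "c * bregman r q v \<le> 0" using var[OF v(1)] hv by (simp add: bregman_def algebra_simps)
    then have "bregman r q v \<le> 0" using c(2) by (simp add: mult_le_0_iff)
    then show ?thesis by (rule bregman_eq_0_imp_eq[rotated 2]) (use q v qi vi in auto)
  qed
qed

end


section \<open>Measurable maximization\<close>

lemma cSUP_eq_maximum:
  fixes f :: "'a \<Rightarrow> real"
  assumes "p \<in> S" "\<And>v. v \<in> S \<Longrightarrow> f v \<le> f p"
  shows "(SUP v\<in>S. f v) = f p"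
  by (rule cSup_eq_maximum) (use assms in auto)

lemma cSUP_dense_subset:
  fixes f :: "'a::metric_space \<Rightarrow> real"
  assumes D: "D \<subseteq> S" "S \<subseteq> closure D" "D \<noteq> {}"
    and f: "continuous_on S f" and bdd: "bdd_above (f ` S)"
  shows "(SUP v\<in>D. f v) = (SUP v\<in>S. f v)"
proof (rule antisym)
  show "(SUP v\<in>D. f v) \<le> (SUP v\<in>S. f v)"
    by (rule cSUP_subset_mono) (use D bdd in auto)
  have bD: "bdd_above (f ` D)" using bdd D(1) by (meson bdd_above_mono image_mono)
  show "(SUP v\<in>S. f v) \<le> (SUP v\<in>D. f v)"
  proof (rule cSUP_least)
    show "S \<noteq> {}" using D by auto
    fix v assume v: "v \<in> S"
    show "f v \<le> (SUP v\<in>D. f v)"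
    proof (rule field_le_epsilon)
      fix e :: real assume "e > 0"
      then obtain d where d: "d > 0" "\<And>v'. v' \<in> S \<Longrightarrow> dist v' v < d \<Longrightarrow> dist (f v') (f v) < e"
        using f v unfolding continuous_on_iff by meson
      obtain v' where v': "v' \<in> D" "dist v' v < d"
        using D(2) v d(1) unfolding closure_approachable by (meson subsetD closure_approachable)
      have "f v < f v' + e" using d(2)[of v'] v' D(1) by (auto simp: dist_real_def)
      moreover have "f v' \<le> (SUP v\<in>D. f v)" by (rule cSUP_upper[OF v'(1) bD])
      ultimately show "f v \<le> (SUP v\<in>D. f v) + e" by linarith
    qed
  qed
qed

lemma borel_measurable_SUP_caratheodory:
  fixes G :: "'w \<Rightarrow> 'b::euclidean_space \<Rightarrow> real"
  assumes meas: "\<And>v. v \<in> S \<Longrightarrow> (\<lambda>\<omega>. G \<omega> v) \<in> borel_measurable M"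
    and cont: "\<And>\<omega>. \<omega> \<in> space M \<Longrightarrow> continuous_on S (G \<omega>)"
    and bdd: "\<And>\<omega>. \<omega> \<in> space M \<Longrightarrow> bdd_above (G \<omega> ` S)"
  shows "(\<lambda>\<omega>. SUP v\<in>S. G \<omega> v) \<in> borel_measurable M"
proof (cases "S = {}")
  case False
  obtain D where D: "countable D" "D \<subseteq> S" "S \<subseteq> closure D" using separable by blast
  have ne: "D \<noteq> {}" using D False by auto
  have "(\<lambda>\<omega>. SUP v\<in>D. G \<omega> v) \<in> borel_measurable M"
  proof (rule borel_measurable_cSUP[OF D(1)])
    show "bdd_above ((\<lambda>v. G \<omega> v) ` D)" if "\<omega> \<in> space M" for \<omega>
      using bdd[OF that] D(2) by (meson bdd_above_mono image_mono)
  qed (use meas D in auto)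
  also have "(\<lambda>\<omega>. SUP v\<in>D. G \<omega> v) \<in> borel_measurable M \<longleftrightarrow> ?thesis"
    by (intro measurable_cong cSUP_dense_subset D ne cont bdd)
  finally show ?thesis .
qed simp

text \<open>
  For compact \<open>T\<close> the maximizer lies in \<open>T\<close> exactly when the supremum over \<open>T\<close> equals the supremum
  over \<open>S\<close>: by compactness the former is attained, and by uniqueness only at \<open>a \<omega>\<close>. Both suprema are
  measurable, and closed sets are countable unions of compact ones.
\<close>

lemma borel_measurable_unique_maximizer:
  fixes G :: "'w \<Rightarrow> 'b::euclidean_space \<Rightarrow> real"
  assumes S: "closed S"
    and meas: "\<And>v. v \<in> S \<Longrightarrow> (\<lambda>\<omega>. G \<omega> v) \<in> borel_measurable M"
    and cont: "\<And>\<omega>. \<omega> \<in> space M \<Longrightarrow> continuous_on S (G \<omega>)"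
    and a: "\<And>\<omega>. \<omega> \<in> space M \<Longrightarrow> a \<omega> \<in> S"
    and max: "\<And>\<omega> v. \<omega> \<in> space M \<Longrightarrow> v \<in> S \<Longrightarrow> G \<omega> v \<le> G \<omega> (a \<omega>)"
    and unique: "\<And>\<omega> v. \<omega> \<in> space M \<Longrightarrow> v \<in> S \<Longrightarrow> G \<omega> v = G \<omega> (a \<omega>) \<Longrightarrow> v = a \<omega>"
  shows "a \<in> borel_measurable M"
proof -
  have bdd: "bdd_above (G \<omega> ` T)" if "\<omega> \<in> space M" "T \<subseteq> S" for \<omega> T
    using that max unfolding bdd_above_def by (intro exI[of _ "G \<omega> (a \<omega>)"]) auto
  have SUP_S: "(SUP v\<in>S. G \<omega> v) = G \<omega> (a \<omega>)" if "\<omega> \<in> space M" for \<omega>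
    by (rule cSUP_eq_maximum) (use a max that in auto)
  have compact: "{\<omega> \<in> space M. a \<omega> \<in> T} \<in> sets M" if T: "compact T" "T \<subseteq> S" for T
  proof (cases "T = {}")
    case False
    have "(\<lambda>\<omega>. SUP v\<in>T. G \<omega> v) \<in> borel_measurable M" "(\<lambda>\<omega>. SUP v\<in>S. G \<omega> v) \<in> borel_measurable M"
      using T(2) by (auto intro!: borel_measurable_SUP_caratheodory meas bdd
          intro: continuous_on_subset[OF cont])
    then have "{\<omega> \<in> space M. (SUP v\<in>T. G \<omega> v) = (SUP v\<in>S. G \<omega> v)} \<in> sets M" by simp
    also have "{\<omega> \<in> space M. (SUP v\<in>T. G \<omega> v) = (SUP v\<in>S. G \<omega> v)} = {\<omega> \<in> space M. a \<omega> \<in> T}"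
    proof -
      have "(SUP v\<in>T. G \<omega> v) = (SUP v\<in>S. G \<omega> v) \<longleftrightarrow> a \<omega> \<in> T" if \<omega>: "\<omega> \<in> space M" for \<omega>
      proof
        assume eq: "(SUP v\<in>T. G \<omega> v) = (SUP v\<in>S. G \<omega> v)"
        obtain p where p: "p \<in> T" "\<And>v. v \<in> T \<Longrightarrow> G \<omega> v \<le> G \<omega> p"
          using continuous_attains_sup[OF T(1) False continuous_on_subset[OF cont[OF \<omega>] T(2)]] by blast
        have "(SUP v\<in>T. G \<omega> v) = G \<omega> p" by (rule cSUP_eq_maximum) (use p in auto)
        then have "p = a \<omega>" using eq SUP_S[OF \<omega>] unique[OF \<omega>] p(1) T(2) by auto
        then show "a \<omega> \<in> T" using p(1) by simp
      next
        assume "a \<omega> \<in> T"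
        then have "(SUP v\<in>T. G \<omega> v) = G \<omega> (a \<omega>)" using max[OF \<omega>] T(2) by (intro cSUP_eq_maximum) auto
        then show "(SUP v\<in>T. G \<omega> v) = (SUP v\<in>S. G \<omega> v)" using SUP_S[OF \<omega>] by simp
      qed
      then show ?thesis by blast
    qed
    finally show ?thesis .
  qed simp
  show ?thesis
    unfolding borel_eq_closed
  proof (rule measurable_measure_of)
    fix F :: "'b set" assume "F \<in> Collect closed"
    then have F: "closed F" by simp
    have "a -` F \<inter> space M = (\<Union>n::nat. {\<omega> \<in> space M. a \<omega> \<in> F \<inter> S \<inter> cball 0 n})"
    proof (intro equalityI subsetI)
      fix \<omega> assume \<omega>: "\<omega> \<in> a -` F \<inter> space M"
      obtain n :: nat where "norm (a \<omega>) \<le> n" using real_arch_simple by blast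
      then show "\<omega> \<in> (\<Union>n::nat. {\<omega> \<in> space M. a \<omega> \<in> F \<inter> S \<inter> cball 0 n})" using \<omega> a by auto
    qed auto
    also have "\<dots> \<in> sets M"
      using F S by (intro sets.countable_UN image_subsetI compact closed_Int_compact closed_Int) auto
    finally show "a -` F \<inter> space M \<in> sets M" .
  qed simp_all
qed

lemma borel_measurable_compose_continuous_on:
  fixes g :: "'b::euclidean_space \<Rightarrow> real"
  assumes S: "closed S" and g: "continuous_on S g"
    and a: "a \<in> borel_measurable M" "\<And>\<omega>. \<omega> \<in> space M \<Longrightarrow> a \<omega> \<in> S"
  shows "(\<lambda>\<omega>. g (a \<omega>)) \<in> borel_measurable M"
proof -
  have "(\<lambda>v. indicator S v *\<^sub>R g v) \<in> borel_measurable borel"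
    using S g by (intro borel_measurable_continuous_on_indicator) auto
  then have "(\<lambda>\<omega>. indicator S (a \<omega>) *\<^sub>R g (a \<omega>)) \<in> borel_measurable M"
    using a(1) by (rule measurable_compose_rev)
  also have "(\<lambda>\<omega>. indicator S (a \<omega>) *\<^sub>R g (a \<omega>)) \<in> borel_measurable M \<longleftrightarrow> ?thesis"
    by (rule measurable_cong) (use a(2) in auto)
  finally show ?thesis .
qed

text \<open>
  The gradient is a pointwise limit of difference quotients. Since \<open>r\<close> is meaningful on \<open>P\<close> only,
  it is first extended by \<open>0\<close> to a Borel function; near an interior point the extension does not
  change the quotients.
\<close>

lemma (in dgf_setup) borel_measurable_gradient:
  assumes a: "a \<in> borel_measurable M" "\<And>\<omega>. \<omega> \<in> space M \<Longrightarrow> a \<omega> \<in> interior P"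
  shows "(\<lambda>\<omega>. gradient r (a \<omega>)) \<in> borel_measurable M"
proof -
  define r' where "r' = (\<lambda>v. indicator P v *\<^sub>R r v)"
  have r': "r' \<in> borel_measurable borel"
    unfolding r'_def using closed_P continuous_r by (intro borel_measurable_continuous_on_indicator) auto
  have "(\<lambda>\<omega>. gradient r (a \<omega>) \<bullet> d) \<in> borel_measurable M" for d
  proof (rule borel_measurable_LIMSEQ_real)
    show "(\<lambda>\<omega>. (r' (a \<omega> + inverse (Suc n) *\<^sub>R d) - r' (a \<omega>)) / inverse (Suc n)) \<in> borel_measurable M" for n
      using a(1) by (intro borel_measurable_divide borel_measurable_diff measurable_compose[OF _ r']) auto
    fix \<omega> assume \<omega>: "\<omega> \<in> space M"
    have ev: "\<forall>\<^sub>F n in sequentially. a \<omega> + inverse (Suc n) *\<^sub>R d \<in> interior P"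
    proof (rule topological_tendstoD)
      have "(\<lambda>n. a \<omega> + inverse (real (Suc n)) *\<^sub>R d) \<longlonglongrightarrow> a \<omega> + 0 *\<^sub>R d"
        by (intro tendsto_intros LIMSEQ_inverse_real_of_nat)
      then show "(\<lambda>n. a \<omega> + inverse (Suc n) *\<^sub>R d) \<longlonglongrightarrow> a \<omega>" by simp
    qed (use a \<omega> in auto)
    have "(\<lambda>n. (r (a \<omega> + inverse (Suc n) *\<^sub>R d) - r (a \<omega>)) / inverse (Suc n)) \<longlonglongrightarrow> gradient r (a \<omega>) \<bullet> d"
    proof (rule filterlim_compose[OF directional_derivative_gradient])
      show "r differentiable at (a \<omega>)" using differentiable_r a(2)[OF \<omega>] .
      show "filterlim (\<lambda>n. inverse (real (Suc n))) (at 0) sequentially"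
        unfolding filterlim_at using LIMSEQ_inverse_real_of_nat by auto
    qed
    moreover have "\<forall>\<^sub>F n in sequentially. (r (a \<omega> + inverse (Suc n) *\<^sub>R d) - r (a \<omega>)) / inverse (Suc n)
        = (r' (a \<omega> + inverse (Suc n) *\<^sub>R d) - r' (a \<omega>)) / inverse (Suc n)"
      using ev
    proof eventually_elim
      case (elim n)
      then show ?case using a(2)[OF \<omega>] interior_subset[of P] by (auto simp: r'_def indicator_def)
    qed
    ultimately show "(\<lambda>n. (r' (a \<omega> + inverse (Suc n) *\<^sub>R d) - r' (a \<omega>)) / inverse (Suc n)) \<longlonglongrightarrow> gradient r (a \<omega>) \<bullet> d"
      by (rule Lim_transform_eventually)
  qed
  then show ?thesis by (subst borel_measurable_euclidean_space) blast
qed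

section \<open>Integrating a conditional guarantee\<close>

text \<open>
  The real conditional expectation is linear on integrable functions only, and the oracle does not
  promise integrability. Conditional expectations of nonnegative functions are additive, and with positive and
  negative parts
  \<open>(f - c) + f\<^sup>- + c\<^sup>+ = f\<^sup>+ + c\<^sup>-\<close>
  has only nonnegative terms. After conditioning, the right-hand side is finite almost everywhere:
  the first term by assumption, the second because \<open>c\<close> is \<open>F\<close>-measurable. Thus the identity can be
  solved for the conditional expectation of \<open>f - c\<close>.
\<close>

lemma (in sigma_finite_subalgebra) nn_integral_gap_le:
  assumes f: "f \<in> borel_measurable M" and c: "c \<in> borel_measurable F"
    and le: "\<And>\<omega>. \<omega> \<in> space M \<Longrightarrow> c \<omega> \<le> f \<omega>"
    and ce: "AE \<omega> in M. nn_cond_exp M F (\<lambda>\<omega>. ennreal (f \<omega>)) \<omega> < \<infinity> \<and> real_cond_exp M F f \<omega> \<le> c \<omega> + e"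
  shows "(\<integral>\<^sup>+\<omega>. ennreal (f \<omega> - c \<omega>) \<partial>M) \<le> (\<integral>\<^sup>+\<omega>. ennreal e \<partial>M)"
proof -
  have cM: "c \<in> borel_measurable M" by (rule measurable_from_subalg[OF subalg c])
  let ?E = "nn_cond_exp M F"
  let ?g = "\<lambda>\<omega>. ennreal (f \<omega> - c \<omega>)"
  have g: "?g \<in> borel_measurable M" using f cM by simp
  \<comment> \<open>Coercion to extended nonnegative reals sends negative numbers to \<open>0\<close>,
    so \<open>ennreal (- f \<omega>)\<close> is the negative part of \<open>f\<close>.\<close>
  have id: "?g \<omega> + ennreal (- f \<omega>) + ennreal (c \<omega>) = ennreal (f \<omega>) + ennreal (- c \<omega>)" if "\<omega> \<in> space M" for \<omega>
    using le[OF that] by (cases "0 \<le> f \<omega>"; cases "0 \<le> c \<omega>") (simp_all add: ennreal_neg flip: ennreal_plus)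
  have E1: "AE \<omega> in M. ?E ?g \<omega> + ?E (\<lambda>\<omega>. ennreal (- f \<omega>)) \<omega> = ?E (\<lambda>\<omega>. ?g \<omega> + ennreal (- f \<omega>)) \<omega>"
    by (rule nn_cond_exp_sum) (use f cM in simp_all)
  have E2: "AE \<omega> in M. ?E (\<lambda>\<omega>. ?g \<omega> + ennreal (- f \<omega>)) \<omega> + ?E (\<lambda>\<omega>. ennreal (c \<omega>)) \<omega>
      = ?E (\<lambda>\<omega>. ?g \<omega> + ennreal (- f \<omega>) + ennreal (c \<omega>)) \<omega>"
    by (rule nn_cond_exp_sum) (use f cM in simp_all)
  have E3: "AE \<omega> in M. ?E (\<lambda>\<omega>. ennreal (f \<omega>)) \<omega> + ?E (\<lambda>\<omega>. ennreal (- c \<omega>)) \<omega>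
      = ?E (\<lambda>\<omega>. ennreal (f \<omega>) + ennreal (- c \<omega>)) \<omega>"
    by (rule nn_cond_exp_sum) (use f cM in simp_all)
  have E4: "AE \<omega> in M. ?E (\<lambda>\<omega>. ?g \<omega> + ennreal (- f \<omega>) + ennreal (c \<omega>)) \<omega>
      = ?E (\<lambda>\<omega>. ennreal (f \<omega>) + ennreal (- c \<omega>)) \<omega>"
    by (rule nn_cond_exp_cong) (use id f cM in auto)
  have E5: "AE \<omega> in M. ennreal (c \<omega>) = ?E (\<lambda>\<omega>. ennreal (c \<omega>)) \<omega>"
    "AE \<omega> in M. ennreal (- c \<omega>) = ?E (\<lambda>\<omega>. ennreal (- c \<omega>)) \<omega>"
    by (rule nn_cond_exp_F_meas, use c in simp)+
  have E6: "AE \<omega> in M. ?E (\<lambda>\<omega>. ennreal (- f \<omega>)) \<omega> \<le> ?E (\<lambda>\<omega>. ennreal (- c \<omega>)) \<omega>"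
    by (rule nn_cond_exp_mono) (use f cM le in \<open>auto intro!: ennreal_leI\<close>)
  have "AE \<omega> in M. ?E ?g \<omega> \<le> ennreal e"
    using E1 E2 E3 E4 E5 E6 ce
  proof eventually_elim
    case (elim \<omega>)
    define G where "G = ?E ?g \<omega>"
    have eq: "G + ?E (\<lambda>\<omega>. ennreal (- f \<omega>)) \<omega> + ennreal (c \<omega>) = ?E (\<lambda>\<omega>. ennreal (f \<omega>)) \<omega> + ennreal (- c \<omega>)"
      using elim unfolding G_def by metis
    have "?E (\<lambda>\<omega>. ennreal (- f \<omega>)) \<omega> \<le> ennreal (- c \<omega>)" using elim by metis
    then have "?E (\<lambda>\<omega>. ennreal (- f \<omega>)) \<omega> < top" by (meson ennreal_less_top le_less_trans)
    then obtain b where b: "b \<ge> 0" "?E (\<lambda>\<omega>. ennreal (- f \<omega>)) \<omega> = ennreal b"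
      by (cases "?E (\<lambda>\<omega>. ennreal (- f \<omega>)) \<omega>") auto
    obtain a where a: "a \<ge> 0" "?E (\<lambda>\<omega>. ennreal (f \<omega>)) \<omega> = ennreal a"
      using elim by (cases "?E (\<lambda>\<omega>. ennreal (f \<omega>)) \<omega>") auto
    have ab: "a - b \<le> c \<omega> + e" using elim a b by (simp add: real_cond_exp_def)
    have "G \<noteq> top" using eq[symmetric] a by auto
    then obtain x where x: "x \<ge> 0" "G = ennreal x" by (cases G) auto
    have "ennreal (x + b + max 0 (c \<omega>)) = ennreal (a + max 0 (- c \<omega>))"
    proof -
      have "ennreal (x + b + max 0 (c \<omega>)) = ennreal x + ennreal b + ennreal (c \<omega>)"
        using b x by simp
      also have "\<dots> = ennreal a + ennreal (- c \<omega>)" using eq a b x by simp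
      also have "\<dots> = ennreal (a + max 0 (- c \<omega>))" using a by simp
      finally show ?thesis .
    qed
    then have "x + b + max 0 (c \<omega>) = a + max 0 (- c \<omega>)"
      by (rule ennreal_inj[THEN iffD1, rotated 2]) (use a b x in auto)
    then have "x \<le> e" using ab by (auto simp: max_def split: if_splits)
    then show ?case unfolding G_def[symmetric] x by (rule ennreal_leI)
  qed
  then have "(\<integral>\<^sup>+\<omega>. ?E ?g \<omega> \<partial>M) \<le> (\<integral>\<^sup>+\<omega>. ennreal e \<partial>M)" by (rule nn_integral_mono_AE)
  moreover have "(\<integral>\<^sup>+\<omega>. ?E ?g \<omega> \<partial>M) = (\<integral>\<^sup>+\<omega>. ?g \<omega> \<partial>M)"
    using nn_cond_exp_intg[of "\<lambda>_. 1" ?g] g by simp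
  ultimately show ?thesis by simp
qed


section \<open>Regularized objectives of a dual-extraction setup\<close>

lemma is_arg_max_iff:
  fixes f :: "'a \<Rightarrow> real"
  shows "is_arg_max f Q p \<longleftrightarrow> Q p \<and> (\<forall>v. Q v \<longrightarrow> f v \<le> f p)"
  by (auto simp: is_arg_max_def not_less)

context dgf_setup
begin

lemma bregman_continuous_on: "continuous_on P (bregman r q)"
  unfolding bregman_def by (intro continuous_intros continuous_r)

lemma bregman_convex_on: "convex_on P (bregman r q)"
  unfolding convex_on_def
proof (intro conjI convex_P ballI allI impI)
  fix v w and s t :: real assume v: "v \<in> P" "w \<in> P" and st: "0 \<le> s" "0 \<le> t" "s + t = 1"
  have "r (s *\<^sub>R v + t *\<^sub>R w) \<le> s * r v + t * r w"
    using convex_r v st by (simp add: convex_on_def)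
  moreover have "s *\<^sub>R v + t *\<^sub>R w - q = s *\<^sub>R (v - q) + t *\<^sub>R (w - q)"
    using st(3) by (simp add: algebra_simps flip: scaleR_add_left)
  moreover have "r q = s * r q + t * r q" using st(3) by (simp flip: distrib_right)
  ultimately show "bregman r q (s *\<^sub>R v + t *\<^sub>R w) \<le> s * bregman r q v + t * bregman r q w"
    unfolding bregman_def by (simp only: inner_add_right inner_scaleR_right) (simp add: right_diff_distrib)
qed

lemma borel_measurable_bregman:
  assumes a: "a \<in> borel_measurable M" "\<And>\<omega>. \<omega> \<in> space M \<Longrightarrow> a \<omega> \<in> interior P"
    and b: "b \<in> borel_measurable M" "\<And>\<omega>. \<omega> \<in> space M \<Longrightarrow> b \<omega> \<in> P"
  shows "(\<lambda>\<omega>. bregman r (a \<omega>) (b \<omega>)) \<in> borel_measurable M"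
proof -
  have "a \<omega> \<in> P" if "\<omega> \<in> space M" for \<omega> using a(2)[OF that] interior_subset by auto
  then have "(\<lambda>\<omega>. r (a \<omega>)) \<in> borel_measurable M" "(\<lambda>\<omega>. r (b \<omega>)) \<in> borel_measurable M"
    using a b by (auto intro: borel_measurable_compose_continuous_on[OF closed_P continuous_r])
  then show ?thesis
    unfolding bregman_def using a(1) b(1) borel_measurable_gradient[OF a] by measurable
qed

end

context dual_extraction_setup
begin

abbreviation phi :: "real^'n \<Rightarrow> real" where "phi \<equiv> dual_objective psi X"
abbreviation reg :: "real \<Rightarrow> real^'n \<Rightarrow> real^'d \<Rightarrow> real" where
  "reg lam q \<equiv> reg_primal_objective psi Y r lam q"

lemma psi_continuous_primal: "continuous_on S (\<lambda>x. psi x y)"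
  using convex_on_continuous[OF open_UNIV convex_psi] continuous_on_subset by blast

lemma psi_continuous_dual: "continuous_on S (psi x)"
proof -
  have "convex_on UNIV (\<lambda>y. - psi x y)" using concave_psi[of x] by (simp add: concave_on_def)
  then have "continuous_on UNIV (\<lambda>y. - (- psi x y))"
    by (intro continuous_on_minus convex_on_continuous) auto
  then show ?thesis using continuous_on_subset by fastforce
qed

lemma primal_sublevel_bounded: "bounded {x \<in> X. psi x y \<le> \<alpha>}"
  using X_bounded_or_strongly_convex
proof
  assume "bounded X" then show ?thesis by (rule bounded_subset) auto
next
  assume "\<forall>y. \<exists>m>0. strongly_convex_on norm m UNIV (\<lambda>x. psi x y)"
  then obtain m where "m > 0" "strongly_convex_on norm m UNIV (\<lambda>x. psi x y)" by auto
  then have "bounded {x. psi x y \<le> \<alpha>}"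
    by (intro strongly_convex_sublevel_bounded psi_continuous_primal)
  then show ?thesis by (rule bounded_subset) auto
qed

lemma dual_superlevel_bounded: "bounded {y \<in> Y. \<alpha> \<le> psi x y}"
  using Y_bounded_or_strongly_concave
proof
  assume "bounded Y" then show ?thesis by (rule bounded_subset) auto
next
  assume "\<forall>x. \<exists>m>0. strongly_convex_on norm m UNIV (\<lambda>y. - psi x y)"
  then obtain m where "m > 0" "strongly_convex_on norm m UNIV (\<lambda>y. - psi x y)" by auto
  then have "bounded {y. - psi x y \<le> - \<alpha>}"
    by (intro strongly_convex_sublevel_bounded continuous_on_minus psi_continuous_dual)
  then show ?thesis by (rule bounded_subset) auto
qed

lemma dual_objective_attained: "\<exists>x\<in>X. phi y = psi x y \<and> (\<forall>x'\<in>X. psi x y \<le> psi x' y)"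
proof -
  have "\<exists>x\<in>X. \<forall>x'\<in>X. - psi x' y \<le> - psi x y"
  proof (rule attains_max_if_superlevel_bounded[OF closed_X X_nonempty])
    show "continuous_on X (\<lambda>x. - psi x y)" by (intro continuous_on_minus psi_continuous_primal)
    show "- psi x y \<le> - psi x y + 0" for x by simp
    show "bounded {x \<in> X. \<alpha> \<le> - psi x y}" for \<alpha>
      using primal_sublevel_bounded[of y "- \<alpha>"] by (simp add: le_minus_iff)
  qed
  then obtain x where x: "x \<in> X" "\<And>x'. x' \<in> X \<Longrightarrow> psi x y \<le> psi x' y" by auto
  then have "phi y = psi x y" unfolding dual_objective_def by (intro cInf_eq_minimum) auto
  then show ?thesis using x by auto
qed

lemma dual_objective_le: "x \<in> X \<Longrightarrow> phi y \<le> psi x y"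
  using dual_objective_attained[of y] by auto

lemma dual_objective_concave: "convex_on UNIV (\<lambda>y. - phi y)"
  unfolding convex_on_def
proof (intro conjI ballI allI impI)
  fix y y' :: "real^'n" and s t :: real assume st: "0 \<le> s" "0 \<le> t" "s + t = 1"
  let ?z = "s *\<^sub>R y + t *\<^sub>R y'"
  obtain x where x: "x \<in> X" "phi ?z = psi x ?z" using dual_objective_attained by blast
  have "- psi x ?z \<le> s * (- psi x y) + t * (- psi x y')"
    using concave_psi[of x] st by (simp add: concave_on_def convex_on_def)
  moreover have "s * phi y \<le> s * psi x y" "t * phi y' \<le> t * psi x y'"
    using st dual_objective_le[OF x(1)] by (auto intro: mult_left_mono)
  ultimately show "- phi ?z \<le> s * (- phi y) + t * (- phi y')" using x(2) by simp
qed simp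

lemma dual_objective_continuous: "continuous_on S phi"
proof -
  have "continuous_on UNIV (\<lambda>y. - (- phi y))"
    by (intro continuous_on_minus convex_on_continuous dual_objective_concave) auto
  then show ?thesis using continuous_on_subset by fastforce
qed

lemma Y_subset_P: "Y \<subseteq> P" using Y_subset_U U_subset_P by auto

text \<open>
  The divergence only lowers \<open>h\<close>, so the superlevel sets inherit boundedness from \<open>psi x\<close>. Both
  \<open>psi x\<close> itself and the dual objective serve as \<open>h\<close>.
\<close>

lemma reg_dual_attained:
  assumes h: "continuous_on Y h" and le: "\<And>v. v \<in> Y \<Longrightarrow> h v \<le> psi x v"
    and q: "q \<in> interior P" and lam: "lam \<ge> 0"
  shows "\<exists>p\<in>Y. \<forall>v\<in>Y. h v - lam * bregman r q v \<le> h p - lam * bregman r q p"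
proof (rule attains_max_if_superlevel_bounded[OF closed_Y Y_nonempty])
  show "continuous_on Y (\<lambda>v. h v - lam * bregman r q v)"
    by (intro continuous_intros h continuous_on_subset[OF bregman_continuous_on Y_subset_P])
  show "h v - lam * bregman r q v \<le> psi x v + 0" if "v \<in> Y" for v
  proof -
    have "0 \<le> lam * bregman r q v" using bregman_nonneg[OF q] that Y_subset_P lam by auto
    then show ?thesis using le[OF that] by simp
  qed
qed (rule dual_superlevel_bounded)

lemma reg_primal_attained:
  assumes q: "q \<in> interior P" and lam: "lam \<ge> 0"
  shows "\<exists>p\<in>Y. reg lam q x = psi x p - lam * bregman r q p
            \<and> (\<forall>v\<in>Y. psi x v - lam * bregman r q v \<le> reg lam q x)"
proof -
  obtain p where p: "p \<in> Y" "\<And>v. v \<in> Y \<Longrightarrow> psi x v - lam * bregman r q v \<le> psi x p - lam * bregman r q p"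
    using reg_dual_attained[OF psi_continuous_dual order_refl q lam] by blast
  have "reg lam q x = psi x p - lam * bregman r q p"
    unfolding reg_primal_objective_def by (rule cSUP_eq_maximum) (use p in auto)
  then show ?thesis using p by auto
qed

lemma reg_primal_ge:
  assumes "q \<in> interior P" "lam \<ge> 0" "v \<in> Y"
  shows "psi x v - lam * bregman r q v \<le> reg lam q x"
  using reg_primal_attained[OF assms(1,2)] assms(3) by blast

text \<open>
  A pointwise maximum of convex functions that is finite on the whole space is convex, hence
  continuous.
\<close>

lemma reg_primal_continuous:
  assumes q: "q \<in> interior P" and lam: "lam \<ge> 0"
  shows "continuous_on S (reg lam q)"
proof -
  have "convex_on UNIV (reg lam q)"
    unfolding convex_on_def
  proof (intro conjI ballI allI impI)
    fix x x' :: "real^'d" and s t :: real assume st: "0 \<le> s" "0 \<le> t" "s + t = 1"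
    let ?z = "s *\<^sub>R x + t *\<^sub>R x'"
    obtain p where p: "p \<in> Y" "reg lam q ?z = psi ?z p - lam * bregman r q p"
      using reg_primal_attained[OF q lam] by blast
    let ?b = "lam * bregman r q p"
    have "psi ?z p \<le> s * psi x p + t * psi x' p"
      using convex_psi[of p] st by (simp add: convex_on_def)
    moreover have "s * (psi x p - ?b) \<le> s * reg lam q x" "t * (psi x' p - ?b) \<le> t * reg lam q x'"
      using st reg_primal_ge[OF q lam p(1)] by (auto intro: mult_left_mono)
    moreover have "s * ?b + t * ?b = ?b" using st(3) by (simp flip: distrib_right)
    ultimately show "reg lam q ?z \<le> s * reg lam q x + t * reg lam q x'"
      using p(2) by (simp add: right_diff_distrib)
  qed simp
  then show ?thesis using convex_on_continuous[OF open_UNIV] continuous_on_subset by blast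
qed

lemma reg_primal_bdd_below:
  assumes q: "q \<in> interior P" and lam: "lam \<ge> 0"
  shows "bdd_below (reg lam q ` X)"
proof -
  obtain v where v: "v \<in> Y" using Y_nonempty by auto
  have "phi v - lam * bregman r q v \<le> reg lam q x" if "x \<in> X" for x
    using reg_primal_ge[OF q lam v, of x] dual_objective_le[OF that, of v] by linarith
  then show ?thesis unfolding bdd_below_def by blast
qed

text \<open>
  Subtracting the divergence shifts the level but not the shape of the sublevel sets in the primal
  variable, so they are compact like those of \<open>psi\<close>, and \<open>minimax_point\<close> applies to every level
  above the regularized dual optimum.
\<close>

lemma reg_minimax:
  assumes q: "q \<in> interior P" and lam: "lam \<ge> 0" and u: "u \<in> Y"
    and max: "\<And>v. v \<in> Y \<Longrightarrow> phi v - lam * bregman r q v \<le> phi u - lam * bregman r q u"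
  shows "(INF x\<in>X. reg lam q x) \<le> phi u - lam * bregman r q u"
proof (rule dense_ge)
  fix \<beta> assume \<beta>: "phi u - lam * bregman r q u < \<beta>"
  let ?F = "\<lambda>x v. psi x v - lam * bregman r q v"
  have "\<exists>x\<in>X. \<forall>v\<in>Y. ?F x v \<le> \<beta>"
  proof (rule minimax_point[where F = ?F and X = X and Y = Y, OF Y_nonempty])
    show "convex_on X (\<lambda>x. ?F x v)" for v
      using convex_on_subset[OF convex_psi[of v] subset_UNIV convex_X]
      by (intro convex_on_diff) (auto simp: concave_on_const convex_X)
    show "concave_on Y (?F x)" for x
    proof (intro concave_on_diff convex_on_cmul lam)
      show "concave_on Y (psi x)"
        using concave_psi[of x] convex_on_subset[OF _ subset_UNIV convex_Y] by (auto simp: concave_on_def)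
      show "convex_on Y (bregman r q)"
        by (rule convex_on_subset[OF bregman_convex_on Y_subset_P convex_Y])
    qed
    show "compact {x \<in> X. ?F x v \<le> \<beta>}" for v
    proof -
      have eq: "{x \<in> X. ?F x v \<le> \<beta>} = {x \<in> X. psi x v \<le> \<beta> + lam * bregman r q v}" by auto
      have "closed (X \<inter> (\<lambda>x. psi x v) -` {..\<beta> + lam * bregman r q v})"
        by (rule continuous_closed_preimage[OF psi_continuous_primal closed_X]) auto
      then have "closed {x \<in> X. psi x v \<le> \<beta> + lam * bregman r q v}"
        by (simp add: vimage_def Int_def)
      then show ?thesis unfolding eq using primal_sublevel_bounded by (simp add: compact_eq_bounded_closed)
    qed
    show "\<exists>x\<in>X. ?F x v < \<beta>" if v: "v \<in> Y" for v
    proof -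
      obtain x where "x \<in> X" "phi v = psi x v" using dual_objective_attained by blast
      then show ?thesis using max[OF v] \<beta> by force
    qed
  qed
  then obtain x where x: "x \<in> X" "\<And>v. v \<in> Y \<Longrightarrow> ?F x v \<le> \<beta>" by blast
  have "(INF x\<in>X. reg lam q x) \<le> reg lam q x" by (rule cINF_lower[OF reg_primal_bdd_below[OF q lam] x(1)])
  also have "\<dots> \<le> \<beta>" using reg_primal_attained[OF q lam, of x] x(2) by auto
  finally show "(INF x\<in>X. reg lam q x) \<le> \<beta>" .
qed

lemma reg_dual_maximizer:
  assumes h: "convex_on Y (\<lambda>v. - h v)" and q: "q \<in> interior P" and lam: "lam > 0"
    and p: "is_arg_max (\<lambda>v. h v - lam * bregman r q v) (\<lambda>v. v \<in> Y) p"
  shows "p \<in> Y \<inter> interior P"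
    and "\<And>v. v \<in> Y \<Longrightarrow> h v - lam * bregman r q v + lam * bregman r p v \<le> h p - lam * bregman r q p"
    and "\<And>v. v \<in> Y \<Longrightarrow> h v - lam * bregman r q v = h p - lam * bregman r q p \<Longrightarrow> v = p"
proof -
  have pY: "p \<in> Y" and min: "\<And>v. v \<in> Y \<Longrightarrow> - h p + lam * bregman r q p \<le> - h v + lam * bregman r q v"
    using p by (auto simp: is_arg_max_iff algebra_simps)
  note * = bregman_proximal_point[OF Y_subset_U h lam q Y_meets_interior pY min]
  show "p \<in> Y \<inter> interior P" using *(1) pY by simp
  show "h v - lam * bregman r q v + lam * bregman r p v \<le> h p - lam * bregman r q p" if "v \<in> Y" for v
  proof -
    have "- h p + lam * bregman r q p + lam * bregman r p v \<le> - h v + lam * bregman r q v"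
      by (rule *(2)[OF _ that])
    then show ?thesis by simp
  qed
  show "v = p" if "v \<in> Y" "h v - lam * bregman r q v = h p - lam * bregman r q p" for v
  proof -
    have "- h v + lam * bregman r q v = - h p + lam * bregman r q p" using that(2) by simp
    then show ?thesis using *(3) that(1) by blast
  qed
qed

lemma neg_psi_convex_on_Y: "convex_on Y (\<lambda>v. - psi x v)"
  using concave_psi[of x] convex_on_subset[OF _ subset_UNIV convex_Y] by (auto simp: concave_on_def)

lemma neg_dual_objective_convex_on_Y: "convex_on Y (\<lambda>v. - phi v)"
  by (rule convex_on_subset[OF dual_objective_concave subset_UNIV convex_Y])

text \<open>
  The regularized primal value at \<open>x\<close> is attained at \<open>y\<close>, and \<open>u\<close> falls short of it by at least
  \<open>lam * bregman r y u\<close>. The value at \<open>u\<close> is at least the regularized dual optimum, which by duality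
  is at least the primal infimum.
\<close>

lemma best_response_gap:
  assumes q: "q \<in> interior P" and lam: "lam > 0" and x: "x \<in> X"
    and y: "drbr_response psi Y r q lam x y"
    and u: "is_arg_max (\<lambda>v. phi v - lam * bregman r q v) (\<lambda>v. v \<in> Y) u"
  shows "lam * bregman r y u \<le> reg lam q x - (INF x'\<in>X. reg lam q x')"
proof -
  have uY: "u \<in> Y" and umax: "\<And>v. v \<in> Y \<Longrightarrow> phi v - lam * bregman r q v \<le> phi u - lam * bregman r q u"
    using u by (auto simp: is_arg_max_iff)
  have yY: "y \<in> Y" using y by (simp add: drbr_response_def is_arg_max_def)
  have "psi x u - lam * bregman r q u + lam * bregman r y u \<le> psi x y - lam * bregman r q y"
    by (rule reg_dual_maximizer(2)[OF neg_psi_convex_on_Y q lam y[unfolded drbr_response_def] uY])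
  also have "\<dots> \<le> reg lam q x" using lam by (intro reg_primal_ge[OF q _ yY]) simp
  finally have "lam * bregman r y u \<le> reg lam q x - (phi u - lam * bregman r q u)"
    using dual_objective_le[OF x, of u] by linarith
  then show ?thesis using reg_minimax[OF q _ uY umax] lam by linarith
qed

text \<open>
  By \<open>weighted_bregman_sum\<close> the terms in \<open>r\<close> cancel. What remains is, up to a constant, a linear
  function whose coefficient vector is normal to \<open>U\<close> at \<open>q\<close>, and such functions are constant on \<open>Y\<close>.
\<close>

lemma bregman_step_constant_on_Y:
  assumes c: "c = (\<Sum>j\<in>J. a j)" "c > 0"
    and q: "q \<in> U"
    and min: "\<And>v. v \<in> U \<Longrightarrow> (\<Sum>j\<in>J. a j * bregman r (y j) q) \<le> (\<Sum>j\<in>J. a j * bregman r (y j) v)"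
    and v: "v \<in> Y" "v' \<in> Y"
  shows "c * bregman r q v - (\<Sum>j\<in>J. a j * bregman r (y j) v)
       = c * bregman r q v' - (\<Sum>j\<in>J. a j * bregman r (y j) v')"
proof -
  define s where "s = (\<Sum>j\<in>J. a j *\<^sub>R gradient r (y j))"
  note * = weighted_bregman_minimizer[OF c q min]
  have "(\<lambda>v. (s - c *\<^sub>R gradient r q) \<bullet> v) constant_on Y"
    unfolding s_def using *(1,2) q by (intro normal_constant_on_Y[of q]) auto
  then have "(s - c *\<^sub>R gradient r q) \<bullet> v = (s - c *\<^sub>R gradient r q) \<bullet> v'"
    using v by (auto simp: constant_on_def)
  then have "s \<bullet> v - c * (gradient r q \<bullet> v) = s \<bullet> v' - c * (gradient r q \<bullet> v')"
    by (simp add: inner_diff_left)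
  then show ?thesis
    unfolding weighted_bregman_sum s_def[symmetric] c(1)[symmetric]
    by (simp add: bregman_def algebra_simps)
qed

end


section \<open>Runs of the framework\<close>

lemma space_history [simp]: "space (history M x k) = space M"
  by (simp add: history_def)

lemma history_measurable_iterate:
  assumes "j \<in> {1..<k}"
  shows "x j \<in> borel_measurable (history M x k)"
proof -
  have "(\<lambda>\<omega>. \<lambda>j\<in>{1..<k}. x j \<omega>) \<in> measurable (history M x k) (PiM {1..<k} (\<lambda>_. borel))"
    unfolding history_def by (rule measurable_vimage_algebra1) (auto simp: space_PiM)
  then have "(\<lambda>\<omega>. (\<lambda>j\<in>{1..<k}. x j \<omega>) j) \<in> borel_measurable (history M x k)"
    using assms by (rule measurable_compose[OF _ measurable_component_singleton])
  then show ?thesis using assms by simp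
qed

lemma subalgebra_history:
  assumes "\<And>j. j \<in> {1..<k} \<Longrightarrow> x j \<in> borel_measurable M"
  shows "subalgebra M (history M x k)"
proof -
  have m: "(\<lambda>\<omega>. \<lambda>j\<in>{1..<k}. x j \<omega>) \<in> measurable M (PiM {1..<k} (\<lambda>_. borel))"
    using assms by (rule measurable_restrict)
  have "sets (history M x k) \<subseteq> sets M"
    unfolding history_def using measurable_sets[OF m]
    by (subst sets_vimage_algebra2) (auto simp: space_PiM)
  then show ?thesis by (simp add: subalgebra_def)
qed

locale dual_extraction_execution =
  dual_extraction_setup psi X Y U P N r \<mu> + prob_space M
  for psi :: "real^'d \<Rightarrow> real^'n \<Rightarrow> real"
    and X :: "(real^'d) set" and Y U P :: "(real^'n) set"
    and N r :: "real^'n \<Rightarrow> real" and \<mu> :: real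
    and M :: "'w measure" +
  fixes y0 :: "real^'n" and K :: nat and lam eps :: "nat \<Rightarrow> real"
    and q y :: "nat \<Rightarrow> 'w \<Rightarrow> real^'n" and x :: "nat \<Rightarrow> 'w \<Rightarrow> real^'d"
  assumes y0: "y0 \<in> Y \<inter> interior P"
    and lam: "\<And>j. j < K \<Longrightarrow> lam j > 0"
    and run: "dual_extraction_run M psi X Y U r y0 K lam eps q x y"
begin

abbreviation Lam :: "nat \<Rightarrow> real" where "Lam \<equiv> cumulative lam"

lemma Lam_pos: "k \<in> {1..K} \<Longrightarrow> Lam k > 0"
  unfolding cumulative_def using lam by (intro sum_pos) (auto simp: lessThan_empty_iff)

lemma response_0: "\<omega> \<in> space M \<Longrightarrow> y 0 \<omega> = y0"
  using run by (simp add: dual_extraction_run_def)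

lemma run_step:
  assumes "k \<in> {1..K}"
  shows "\<omega> \<in> space M \<Longrightarrow> is_arg_min (\<lambda>p. 1 / Lam k * (\<Sum>j<k. lam j * bregman r (y j \<omega>) p)) (\<lambda>p. p \<in> U) (q k \<omega>)"
    and "drpo_response M (history M x k) psi X Y r (q k) (Lam k) (eps k) (x k)"
    and "\<omega> \<in> space M \<Longrightarrow> drbr_response psi Y r (q k \<omega>) (Lam k) (x k \<omega>) (y k \<omega>)"
  using run assms unfolding dual_extraction_run_def by blast+

lemma query_minimal:
  assumes k: "k \<in> {1..K}" and \<omega>: "\<omega> \<in> space M"
  shows "q k \<omega> \<in> U"
    and "v \<in> U \<Longrightarrow> (\<Sum>j<k. lam j * bregman r (y j \<omega>) (q k \<omega>)) \<le> (\<Sum>j<k. lam j * bregman r (y j \<omega>) v)"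
proof -
  have *: "is_arg_min (\<lambda>p. 1 / Lam k * (\<Sum>j<k. lam j * bregman r (y j \<omega>) p)) (\<lambda>p. p \<in> U) (q k \<omega>)"
    by (rule run_step(1)[OF k \<omega>])
  show "q k \<omega> \<in> U" using * by (simp add: is_arg_min_def)
  assume "v \<in> U"
  then have "1 / Lam k * (\<Sum>j<k. lam j * bregman r (y j \<omega>) (q k \<omega>)) \<le> 1 / Lam k * (\<Sum>j<k. lam j * bregman r (y j \<omega>) v)"
    using * unfolding is_arg_min_linorder by blast
  moreover have "0 < 1 / Lam k" using Lam_pos[OF k] by simp
  ultimately show "(\<Sum>j<k. lam j * bregman r (y j \<omega>) (q k \<omega>)) \<le> (\<Sum>j<k. lam j * bregman r (y j \<omega>) v)"
    by (simp only: mult_le_cancel_left_pos)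
qed

lemma query_interior:
  assumes k: "k \<in> {1..K}" and \<omega>: "\<omega> \<in> space M"
  shows "q k \<omega> \<in> interior P"
  by (rule weighted_bregman_minimizer(1)[OF cumulative_def Lam_pos[OF k] query_minimal[OF k \<omega>]])

lemma iterate_in_X: "k \<in> {1..K} \<Longrightarrow> \<omega> \<in> space M \<Longrightarrow> x k \<omega> \<in> X"
  and iterate_measurable: "k \<in> {1..K} \<Longrightarrow> x k \<in> borel_measurable M"
  using run_step(2) by (auto simp: drpo_response_def)

lemma response_interior:
  assumes "k \<le> K" "\<omega> \<in> space M"
  shows "y k \<omega> \<in> Y \<inter> interior P"
proof (cases "k = 0")
  case False
  then have k: "k \<in> {1..K}" using assms by auto
  show ?thesis
    by (rule reg_dual_maximizer(1)[OF neg_psi_convex_on_Y query_interior[OF k assms(2)] Lam_pos[OF k]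
          run_step(3)[OF k assms(2), unfolded drbr_response_def]])
qed (use assms y0 response_0 in auto)

text \<open>
  Measurability is stated for any \<open>F\<close> on the same space, because queries have to be measurable with
  respect to the history that precedes them, whereas the final points are only needed to be random
  variables on \<open>M\<close>.
\<close>

lemma query_measurable_from_responses:
  assumes F: "space F = space M" and k: "k \<in> {1..K}"
    and y: "\<And>j. j < k \<Longrightarrow> y j \<in> borel_measurable F"
  shows "q k \<in> borel_measurable F"
proof (rule borel_measurable_unique_maximizer[OF closed_U,
      where G = "\<lambda>\<omega> v. - (\<Sum>j<k. lam j * bregman r (y j \<omega>) v)"])
  have yi: "y j \<omega> \<in> interior P" if "j < k" "\<omega> \<in> space F" for j \<omega>
    using response_interior[of j \<omega>] that k F by auto
  show "(\<lambda>\<omega>. - (\<Sum>j<k. lam j * bregman r (y j \<omega>) v)) \<in> borel_measurable F" if "v \<in> U" for v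
    using y yi that U_subset_P
    by (intro borel_measurable_uminus borel_measurable_sum borel_measurable_times borel_measurable_const
        borel_measurable_bregman) auto
  fix \<omega> assume \<omega>: "\<omega> \<in> space F"
  then have \<omega>M: "\<omega> \<in> space M" by (simp add: F)
  show "continuous_on U (\<lambda>v. - (\<Sum>j<k. lam j * bregman r (y j \<omega>) v))"
    by (intro continuous_intros continuous_on_subset[OF bregman_continuous_on U_subset_P])
  show "q k \<omega> \<in> U" by (rule query_minimal[OF k \<omega>M])
  fix v assume v: "v \<in> U"
  show "- (\<Sum>j<k. lam j * bregman r (y j \<omega>) v) \<le> - (\<Sum>j<k. lam j * bregman r (y j \<omega>) (q k \<omega>))"
    using query_minimal(2)[OF k \<omega>M v] by simp
  assume "- (\<Sum>j<k. lam j * bregman r (y j \<omega>) v) = - (\<Sum>j<k. lam j * bregman r (y j \<omega>) (q k \<omega>))"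
  then have eq: "(\<Sum>j<k. lam j * bregman r (y j \<omega>) v) = (\<Sum>j<k. lam j * bregman r (y j \<omega>) (q k \<omega>))"
    by simp
  show "v = q k \<omega>"
    by (rule weighted_bregman_minimizer(3)[OF cumulative_def Lam_pos[OF k] query_minimal[OF k \<omega>M] v eq])
qed

lemma reg_integrand_measurable:
  assumes F: "space F = space M" and k: "k \<in> {1..K}" and q: "q k \<in> borel_measurable F"
    and a: "a \<in> borel_measurable F" and v: "v \<in> Y"
  shows "(\<lambda>\<omega>. psi (a \<omega>) v - Lam k * bregman r (q k \<omega>) v) \<in> borel_measurable F"
proof -
  have "(\<lambda>\<omega>. psi (a \<omega>) v) \<in> borel_measurable F"
    by (rule measurable_compose[OF a borel_measurable_continuous_onI[OF psi_continuous_primal]])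
  moreover have "(\<lambda>\<omega>. bregman r (q k \<omega>) v) \<in> borel_measurable F"
    by (rule borel_measurable_bregman[OF q]) (use query_interior[OF k] F v Y_subset_P in auto)
  ultimately show ?thesis by simp
qed

lemma reg_integrand_continuous:
  "continuous_on Y (\<lambda>v. psi z v - c * bregman r p v)"
  by (intro continuous_intros psi_continuous_dual continuous_on_subset[OF bregman_continuous_on Y_subset_P])

lemma reg_measurable:
  assumes F: "space F = space M" and k: "k \<in> {1..K}" and q: "q k \<in> borel_measurable F"
    and a: "a \<in> borel_measurable F"
  shows "(\<lambda>\<omega>. reg (Lam k) (q k \<omega>) (a \<omega>)) \<in> borel_measurable F"
  unfolding reg_primal_objective_def
proof (rule borel_measurable_SUP_caratheodory)
  show "(\<lambda>\<omega>. psi (a \<omega>) v - Lam k * bregman r (q k \<omega>) v) \<in> borel_measurable F" if "v \<in> Y" for v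
    by (rule reg_integrand_measurable[OF F k q a that])
  fix \<omega> assume "\<omega> \<in> space F"
  then have \<omega>: "\<omega> \<in> space M" by (simp add: F)
  show "continuous_on Y (\<lambda>v. psi (a \<omega>) v - Lam k * bregman r (q k \<omega>) v)"
    by (rule reg_integrand_continuous)
  show "bdd_above ((\<lambda>v. psi (a \<omega>) v - Lam k * bregman r (q k \<omega>) v) ` Y)"
    unfolding bdd_above_def
    using reg_primal_ge[OF query_interior[OF k \<omega>] less_imp_le[OF Lam_pos[OF k]]] by blast
qed

lemma INF_reg_measurable:
  assumes F: "space F = space M" and k: "k \<in> {1..K}" and q: "q k \<in> borel_measurable F"
  shows "(\<lambda>\<omega>. INF z\<in>X. reg (Lam k) (q k \<omega>) z) \<in> borel_measurable F"
proof -
  have "(\<lambda>\<omega>. SUP z\<in>X. - reg (Lam k) (q k \<omega>) z) \<in> borel_measurable F"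
  proof (rule borel_measurable_SUP_caratheodory)
    show "(\<lambda>\<omega>. - reg (Lam k) (q k \<omega>) z) \<in> borel_measurable F" for z
      by (intro borel_measurable_uminus reg_measurable F k q) simp
    fix \<omega> assume "\<omega> \<in> space F"
    then have \<omega>: "\<omega> \<in> space M" by (simp add: F)
    note qi = query_interior[OF k \<omega>] less_imp_le[OF Lam_pos[OF k]]
    show "continuous_on X (\<lambda>z. - reg (Lam k) (q k \<omega>) z)"
      by (intro continuous_on_minus reg_primal_continuous qi)
    show "bdd_above ((\<lambda>z. - reg (Lam k) (q k \<omega>) z) ` X)"
      using reg_primal_bdd_below[OF qi] by (simp add: bdd_above_uminus_image)
  qed
  then show ?thesis by (simp add: Inf_real_def image_image)
qed

text \<open>
  The query of step \<open>k\<close> is determined by all earlier responses, and the response by the query and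
  \<open>x k\<close>; hence strong induction.
\<close>

lemma response_measurable:
  assumes F: "space F = space M" and "k \<le> K"
    and "\<And>j. j \<in> {1..k} \<Longrightarrow> x j \<in> borel_measurable F"
  shows "y k \<in> borel_measurable F"
  using assms(2,3)
proof (induction k rule: less_induct)
  case (less k)
  show ?case
  proof (cases "k = 0")
    case True
    have "y 0 \<in> borel_measurable F \<longleftrightarrow> (\<lambda>_. y0) \<in> borel_measurable F"
      by (rule measurable_cong) (simp add: F response_0)
    then show ?thesis using True by simp
  next
    case False
    then have k: "k \<in> {1..K}" using less.prems by auto
    have q: "q k \<in> borel_measurable F"
      by (rule query_measurable_from_responses[OF F k], rule less.IH) (use less.prems in auto)
    have xk: "x k \<in> borel_measurable F" using less.prems False by auto
    show ?thesis
    proof (rule borel_measurable_unique_maximizer[OF closed_Y,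
        where G = "\<lambda>\<omega> v. psi (x k \<omega>) v - Lam k * bregman r (q k \<omega>) v"])
      show "(\<lambda>\<omega>. psi (x k \<omega>) v - Lam k * bregman r (q k \<omega>) v) \<in> borel_measurable F" if "v \<in> Y" for v
        by (rule reg_integrand_measurable[OF F k q xk that])
      fix \<omega> assume "\<omega> \<in> space F"
      then have \<omega>: "\<omega> \<in> space M" by (simp add: F)
      show "continuous_on Y (\<lambda>v. psi (x k \<omega>) v - Lam k * bregman r (q k \<omega>) v)"
        by (rule reg_integrand_continuous)
      have y: "is_arg_max (\<lambda>v. psi (x k \<omega>) v - Lam k * bregman r (q k \<omega>) v) (\<lambda>v. v \<in> Y) (y k \<omega>)"
        using run_step(3)[OF k \<omega>] by (simp add: drbr_response_def)
      then show "y k \<omega> \<in> Y" by (simp add: is_arg_max_iff)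
      fix v assume v: "v \<in> Y"
      then show "psi (x k \<omega>) v - Lam k * bregman r (q k \<omega>) v
          \<le> psi (x k \<omega>) (y k \<omega>) - Lam k * bregman r (q k \<omega>) (y k \<omega>)"
        using y by (simp add: is_arg_max_iff)
      assume "psi (x k \<omega>) v - Lam k * bregman r (q k \<omega>) v
          = psi (x k \<omega>) (y k \<omega>) - Lam k * bregman r (q k \<omega>) (y k \<omega>)"
      then show "v = y k \<omega>"
        by (rule reg_dual_maximizer(3)[OF neg_psi_convex_on_Y query_interior[OF k \<omega>] Lam_pos[OF k] y v])
    qed
  qed
qed

lemma query_measurable:
  assumes F: "space F = space M" and k: "k \<in> {1..K}"
    and x: "\<And>j. j \<in> {1..<k} \<Longrightarrow> x j \<in> borel_measurable F"
  shows "q k \<in> borel_measurable F"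
proof (rule query_measurable_from_responses[OF F k])
  fix j assume j: "j < k"
  show "y j \<in> borel_measurable F"
  proof (rule response_measurable[OF F])
    show "j \<le> K" using j k by simp
    show "x i \<in> borel_measurable F" if "i \<in> {1..j}" for i
      by (rule x) (use that j in simp)
  qed
qed

text \<open>
  The regularized dual maximizer at step \<open>k\<close>; at step \<open>K\<close> it is the witness in the theorem.
\<close>

definition u :: "nat \<Rightarrow> 'w \<Rightarrow> real^'n" where
  "u k \<omega> = (SOME p. is_arg_max (\<lambda>v. phi v - Lam k * bregman r (q k \<omega>) v) (\<lambda>v. v \<in> Y) p)"

lemma dual_maximizer_maximal:
  assumes k: "k \<in> {1..K}" and \<omega>: "\<omega> \<in> space M"
  shows "is_arg_max (\<lambda>v. phi v - Lam k * bregman r (q k \<omega>) v) (\<lambda>v. v \<in> Y) (u k \<omega>)"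
proof -
  obtain z where "z \<in> X" using X_nonempty by auto
  have "\<exists>p\<in>Y. \<forall>v\<in>Y. phi v - Lam k * bregman r (q k \<omega>) v \<le> phi p - Lam k * bregman r (q k \<omega>) p"
  proof (rule reg_dual_attained[where h = phi and x = z])
    show "phi v \<le> psi z v" for v by (rule dual_objective_le[OF \<open>z \<in> X\<close>])
  qed (rule dual_objective_continuous query_interior[OF k \<omega>] less_imp_le[OF Lam_pos[OF k]])+
  then have "\<exists>p. is_arg_max (\<lambda>v. phi v - Lam k * bregman r (q k \<omega>) v) (\<lambda>v. v \<in> Y) p"
    by (auto simp: is_arg_max_iff)
  then show ?thesis unfolding u_def by (rule someI_ex)
qed

lemma dual_maximizer_interior:
  assumes k: "k \<in> {1..K}" and \<omega>: "\<omega> \<in> space M"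
  shows "u k \<omega> \<in> Y \<inter> interior P"
  by (rule reg_dual_maximizer(1)[OF neg_dual_objective_convex_on_Y query_interior[OF k \<omega>] Lam_pos[OF k]
        dual_maximizer_maximal[OF k \<omega>]])

lemma dual_maximizer_measurable:
  assumes k: "k \<in> {1..K}"
  shows "u k \<in> borel_measurable M"
proof (rule borel_measurable_unique_maximizer[OF closed_Y,
    where G = "\<lambda>\<omega> v. phi v - Lam k * bregman r (q k \<omega>) v"])
  have q: "q k \<in> borel_measurable M" by (rule query_measurable[OF refl k iterate_measurable]) (use k in auto)
  show "(\<lambda>\<omega>. phi v - Lam k * bregman r (q k \<omega>) v) \<in> borel_measurable M" if "v \<in> Y" for v
    using that Y_subset_P
    by (intro borel_measurable_diff borel_measurable_times borel_measurable_const
        borel_measurable_bregman q query_interior[OF k]) auto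
  fix \<omega> assume \<omega>: "\<omega> \<in> space M"
  show "continuous_on Y (\<lambda>v. phi v - Lam k * bregman r (q k \<omega>) v)"
    by (intro continuous_intros dual_objective_continuous
        continuous_on_subset[OF bregman_continuous_on Y_subset_P])
  show "u k \<omega> \<in> Y" using dual_maximizer_interior[OF k \<omega>] by simp
  fix v assume v: "v \<in> Y"
  then show "phi v - Lam k * bregman r (q k \<omega>) v \<le> phi (u k \<omega>) - Lam k * bregman r (q k \<omega>) (u k \<omega>)"
    using dual_maximizer_maximal[OF k \<omega>] by (simp add: is_arg_max_iff)
  assume "phi v - Lam k * bregman r (q k \<omega>) v = phi (u k \<omega>) - Lam k * bregman r (q k \<omega>) (u k \<omega>)"
  then show "v = u k \<omega>"
    by (rule reg_dual_maximizer(3)[OF neg_dual_objective_convex_on_Y query_interior[OF k \<omega>] Lam_pos[OF k]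
          dual_maximizer_maximal[OF k \<omega>] v])
qed

lemma dual_maximizer_accumulated:
  assumes k: "k \<in> {1..K}" and \<omega>: "\<omega> \<in> space M" and v: "v \<in> Y"
  shows "phi v - (\<Sum>j<k. lam j * bregman r (y j \<omega>) v)
    \<le> phi (u k \<omega>) - (\<Sum>j<k. lam j * bregman r (y j \<omega>) (u k \<omega>))"
proof -
  have uY: "u k \<omega> \<in> Y" using dual_maximizer_interior[OF k \<omega>] by simp
  have "Lam k * bregman r (q k \<omega>) v - (\<Sum>j<k. lam j * bregman r (y j \<omega>) v)
      = Lam k * bregman r (q k \<omega>) (u k \<omega>) - (\<Sum>j<k. lam j * bregman r (y j \<omega>) (u k \<omega>))"
    by (rule bregman_step_constant_on_Y[OF cumulative_def Lam_pos[OF k] query_minimal[OF k \<omega>] v uY])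
  moreover have "phi v - Lam k * bregman r (q k \<omega>) v \<le> phi (u k \<omega>) - Lam k * bregman r (q k \<omega>) (u k \<omega>)"
    using dual_maximizer_maximal[OF k \<omega>] v by (simp add: is_arg_max_iff)
  ultimately show ?thesis by linarith
qed

text \<open>
  Each \<open>u k\<close> competes in the problem of step \<open>k + 1\<close>, whose objective has one more term
  \<open>lam k * bregman r (y k \<omega>)\<close>; so the optimal value drops by at most that term at \<open>u k\<close>. The first
  step compares with \<open>v\<close> directly.
\<close>

lemma accumulated_suboptimality:
  assumes \<omega>: "\<omega> \<in> space M" and v: "v \<in> Y" and n: "n < K"
  shows "phi v - lam 0 * bregman r y0 v - (\<Sum>k=1..n. lam k * bregman r (y k \<omega>) (u k \<omega>))
    \<le> phi (u (Suc n) \<omega>) - (\<Sum>j<Suc n. lam j * bregman r (y j \<omega>) (u (Suc n) \<omega>))"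
  using n
proof (induction n)
  case 0
  then have "1 \<in> {1..K}" by simp
  from dual_maximizer_accumulated[OF this \<omega> v] show ?case by (simp add: response_0[OF \<omega>])
next
  case (Suc n)
  then have k: "Suc n \<in> {1..K}" "Suc (Suc n) \<in> {1..K}" by simp_all
  have "u (Suc n) \<omega> \<in> Y" using dual_maximizer_interior[OF k(1) \<omega>] by simp
  from dual_maximizer_accumulated[OF k(2) \<omega> this]
  have "phi (u (Suc n) \<omega>) - (\<Sum>j<Suc n. lam j * bregman r (y j \<omega>) (u (Suc n) \<omega>))
        - lam (Suc n) * bregman r (y (Suc n) \<omega>) (u (Suc n) \<omega>)
      \<le> phi (u (Suc (Suc n)) \<omega>) - (\<Sum>j<Suc (Suc n). lam j * bregman r (y j \<omega>) (u (Suc (Suc n)) \<omega>))"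
    unfolding sum.lessThan_Suc[of _ "Suc n"] by linarith
  moreover have "(\<Sum>k=1..Suc n. lam k * bregman r (y k \<omega>) (u k \<omega>))
      = (\<Sum>k=1..n. lam k * bregman r (y k \<omega>) (u k \<omega>)) + lam (Suc n) * bregman r (y (Suc n) \<omega>) (u (Suc n) \<omega>)"
    by simp
  ultimately show ?case using Suc.IH Suc.prems by linarith
qed

lemma dual_suboptimality:
  assumes \<omega>: "\<omega> \<in> space M" and v: "v \<in> Y" and K: "K \<ge> 1"
  shows "phi v - phi (u K \<omega>)
    \<le> lam 0 * bregman r y0 v + (\<Sum>k=1..K-1. lam k * bregman r (y k \<omega>) (u k \<omega>))"
proof -
  have "u K \<omega> \<in> P" using dual_maximizer_interior[of K \<omega>] \<omega> K Y_subset_P by auto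
  then have "0 \<le> (\<Sum>j<K. lam j * bregman r (y j \<omega>) (u K \<omega>))"
    using response_interior[OF _ \<omega>] lam by (intro sum_nonneg mult_nonneg_nonneg bregman_nonneg) (auto simp: less_imp_le)
  then show ?thesis using accumulated_suboptimality[OF \<omega> v, of "K - 1"] K by simp
qed

lemma bregman_response_nonneg: "k \<in> {1..K} \<Longrightarrow> \<omega> \<in> space M \<Longrightarrow> 0 \<le> bregman r (y k \<omega>) (u k \<omega>)"
  using response_interior[of k \<omega>] dual_maximizer_interior[of k \<omega>] Y_subset_P by (intro bregman_nonneg) auto

lemma bregman_response_measurable:
  assumes k: "k \<in> {1..K}"
  shows "(\<lambda>\<omega>. bregman r (y k \<omega>) (u k \<omega>)) \<in> borel_measurable M"
proof (rule borel_measurable_bregman)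
  show "y k \<in> borel_measurable M" by (rule response_measurable[OF refl _ iterate_measurable]) (use k in auto)
qed (use k dual_maximizer_measurable[OF k] response_interior[of k] dual_maximizer_interior[OF k] Y_subset_P in auto)

text \<open>
  The guarantee of the oracle is conditional on the history before step \<open>k\<close>. The query is measurable
  with respect to it, and so is the infimum of the regularized primal objective.
\<close>

lemma nn_integral_bregman_response:
  assumes k: "k \<in> {1..K}" and e: "eps k > 0"
  shows "(\<integral>\<^sup>+\<omega>. ennreal (bregman r (y k \<omega>) (u k \<omega>)) \<partial>M) \<le> ennreal (eps k / Lam k)"
proof -
  define F where "F = history M x k"
  have sub: "subalgebra M F"
    unfolding F_def by (rule subalgebra_history) (use k iterate_measurable in auto)
  interpret F: finite_measure_subalgebra M F
    using sub by unfold_locales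
  have spF: "space F = space M" by (simp add: F_def)
  have qF: "q k \<in> borel_measurable F"
    by (rule query_measurable[OF spF k]) (simp add: F_def history_measurable_iterate)
  let ?f = "\<lambda>\<omega>. reg (Lam k) (q k \<omega>) (x k \<omega>)" and ?c = "\<lambda>\<omega>. INF z\<in>X. reg (Lam k) (q k \<omega>) z"
  have gap: "(\<integral>\<^sup>+\<omega>. ennreal (?f \<omega> - ?c \<omega>) \<partial>M) \<le> (\<integral>\<^sup>+\<omega>. ennreal (eps k) \<partial>M)"
  proof (rule F.nn_integral_gap_le)
    show "?f \<in> borel_measurable M"
      by (intro reg_measurable k iterate_measurable measurable_from_subalg[OF sub qF]) simp
    show "?c \<in> borel_measurable F" by (rule INF_reg_measurable[OF spF k qF])
    show "?c \<omega> \<le> ?f \<omega>" if "\<omega> \<in> space M" for \<omega>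
      by (rule cINF_lower[OF reg_primal_bdd_below[OF query_interior[OF k that] less_imp_le[OF Lam_pos[OF k]]]
            iterate_in_X[OF k that]])
    show "AE \<omega> in M. nn_cond_exp M F (\<lambda>\<omega>. ennreal (?f \<omega>)) \<omega> < \<infinity> \<and> real_cond_exp M F ?f \<omega> \<le> ?c \<omega> + eps k"
      using run_step(2)[OF k] by (simp add: drpo_response_def F_def)
  qed
  have "(\<integral>\<^sup>+\<omega>. ennreal (bregman r (y k \<omega>) (u k \<omega>)) \<partial>M)
      \<le> (\<integral>\<^sup>+\<omega>. ennreal (1 / Lam k) * ennreal (?f \<omega> - ?c \<omega>) \<partial>M)"
  proof (rule nn_integral_mono)
    fix \<omega> assume \<omega>: "\<omega> \<in> space M"
    have "Lam k * bregman r (y k \<omega>) (u k \<omega>) \<le> ?f \<omega> - ?c \<omega>"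
      by (rule best_response_gap[OF query_interior[OF k \<omega>] Lam_pos[OF k] iterate_in_X[OF k \<omega>] run_step(3)[OF k \<omega>]
            dual_maximizer_maximal[OF k \<omega>]])
    then have "bregman r (y k \<omega>) (u k \<omega>) \<le> 1 / Lam k * (?f \<omega> - ?c \<omega>)"
      using Lam_pos[OF k] by (simp add: field_simps)
    then have "ennreal (bregman r (y k \<omega>) (u k \<omega>)) \<le> ennreal (1 / Lam k * (?f \<omega> - ?c \<omega>))"
      by (rule ennreal_leI)
    also have "\<dots> = ennreal (1 / Lam k) * ennreal (?f \<omega> - ?c \<omega>)"
      using Lam_pos[OF k] by (intro ennreal_mult') simp
    finally show "ennreal (bregman r (y k \<omega>) (u k \<omega>)) \<le> ennreal (1 / Lam k) * ennreal (?f \<omega> - ?c \<omega>)" .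
  qed
  also have "\<dots> = ennreal (1 / Lam k) * (\<integral>\<^sup>+\<omega>. ennreal (?f \<omega> - ?c \<omega>) \<partial>M)"
    by (intro nn_integral_cmult measurable_compose[OF _ measurable_ennreal] borel_measurable_diff
        reg_measurable k iterate_measurable measurable_from_subalg[OF sub qF]
        measurable_from_subalg[OF sub INF_reg_measurable[OF spF k qF]]) simp
  also have "\<dots> \<le> ennreal (1 / Lam k) * ennreal (eps k)"
    using gap by (intro mult_left_mono) (simp_all add: emeasure_space_1)
  also have "\<dots> = ennreal (eps k / Lam k)"
    using Lam_pos[OF k] by (subst ennreal_mult'[symmetric]) simp_all
  finally show ?thesis .
qed

lemma expected_bregman_response:
  assumes k: "k \<in> {1..K}" and e: "eps k > 0"
  shows "integrable M (\<lambda>\<omega>. bregman r (y k \<omega>) (u k \<omega>))"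
    and "(\<integral>\<omega>. bregman r (y k \<omega>) (u k \<omega>) \<partial>M) \<le> eps k / Lam k"
proof -
  note nn = nn_integral_bregman_response[OF k e]
  show int: "integrable M (\<lambda>\<omega>. bregman r (y k \<omega>) (u k \<omega>))"
    by (rule integrableI_nonneg[OF bregman_response_measurable[OF k]])
      (use nn bregman_response_nonneg[OF k] in \<open>auto intro: le_less_trans\<close>)
  have "ennreal (\<integral>\<omega>. bregman r (y k \<omega>) (u k \<omega>) \<partial>M) = (\<integral>\<^sup>+\<omega>. ennreal (bregman r (y k \<omega>) (u k \<omega>)) \<partial>M)"
    by (rule nn_integral_eq_integral[symmetric, OF int]) (use bregman_response_nonneg[OF k] in auto)
  also note nn
  finally show "(\<integral>\<omega>. bregman r (y k \<omega>) (u k \<omega>) \<partial>M) \<le> eps k / Lam k"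
    using e Lam_pos[OF k] by (simp add: ennreal_le_iff)
qed

text \<open>
  Integrability comes from the pathwise bound itself: \<open>phi (u K \<omega>)\<close> lies between \<open>phi ystar\<close> minus an
  integrable error and \<open>phi ystar\<close>.
\<close>

lemma expected_suboptimality:
  assumes K: "K \<ge> 1" and e: "\<And>k. k \<in> {1..K} \<Longrightarrow> eps k > 0"
    and ystar: "is_arg_max phi (\<lambda>v. v \<in> Y) ystar"
  shows "integrable M (\<lambda>\<omega>. phi (u K \<omega>))"
    and "phi ystar - (\<integral>\<omega>. phi (u K \<omega>) \<partial>M)
      \<le> lam 0 * bregman r y0 ystar + (\<Sum>k=1..K-1. lam k / Lam k * eps k)"
proof -
  define W where "W \<omega> = lam 0 * bregman r y0 ystar + (\<Sum>k=1..K-1. lam k * bregman r (y k \<omega>) (u k \<omega>))" for \<omega>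
  have KK: "K \<in> {1..K}" using K by simp
  have intk: "integrable M (\<lambda>\<omega>. lam k * bregman r (y k \<omega>) (u k \<omega>))" if "k \<in> {1..K-1}" for k
    using that e by (intro integrable_mult_right expected_bregman_response) auto
  have intW: "integrable M W" unfolding W_def by (intro Bochner_Integration.integrable_add Bochner_Integration.integrable_sum intk) simp_all
  have yY: "ystar \<in> Y" and le: "\<And>v. v \<in> Y \<Longrightarrow> phi v \<le> phi ystar"
    using ystar by (auto simp: is_arg_max_iff)
  have bound: "phi ystar - W \<omega> \<le> phi (u K \<omega>)" "phi (u K \<omega>) \<le> phi ystar" if "\<omega> \<in> space M" for \<omega>
    using dual_suboptimality[OF that yY K] le[of "u K \<omega>"] dual_maximizer_interior[OF KK that] by (auto simp: W_def)
  show int: "integrable M (\<lambda>\<omega>. phi (u K \<omega>))"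
  proof (rule Bochner_Integration.integrable_bound)
    show "integrable M (\<lambda>\<omega>. \<bar>phi ystar\<bar> + \<bar>W \<omega>\<bar>)" using intW by (intro Bochner_Integration.integrable_add integrable_abs) auto
    show "(\<lambda>\<omega>. phi (u K \<omega>)) \<in> borel_measurable M"
      by (rule measurable_compose[OF dual_maximizer_measurable[OF KK] borel_measurable_continuous_onI[OF dual_objective_continuous]])
    show "AE \<omega> in M. norm (phi (u K \<omega>)) \<le> norm (\<bar>phi ystar\<bar> + \<bar>W \<omega>\<bar>)"
      by (rule AE_I2) (use bound in \<open>force simp: abs_le_iff\<close>)
  qed
  have "phi ystar - (\<integral>\<omega>. phi (u K \<omega>) \<partial>M) = (\<integral>\<omega>. phi ystar - phi (u K \<omega>) \<partial>M)"
    using int by (simp add: prob_space)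
  also have "\<dots> \<le> (\<integral>\<omega>. W \<omega> \<partial>M)"
    by (rule integral_mono) (use int intW bound in \<open>auto simp: algebra_simps\<close>)
  also have "\<dots> = lam 0 * bregman r y0 ystar + (\<Sum>k=1..K-1. lam k * (\<integral>\<omega>. bregman r (y k \<omega>) (u k \<omega>) \<partial>M))"
    unfolding W_def using intk by (subst Bochner_Integration.integral_add) (auto simp: prob_space Bochner_Integration.integral_sum)
  also have "\<dots> \<le> lam 0 * bregman r y0 ystar + (\<Sum>k=1..K-1. lam k * (eps k / Lam k))"
    using e by (intro add_left_mono sum_mono mult_left_mono expected_bregman_response less_imp_le[OF lam]) auto
  finally show "phi ystar - (\<integral>\<omega>. phi (u K \<omega>) \<partial>M)
      \<le> lam 0 * bregman r y0 ystar + (\<Sum>k=1..K-1. lam k / Lam k * eps k)"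
    by (simp add: mult_ac)
qed

text \<open>
  The distance \<open>d\<close> between the two points satisfies \<open>d \<le> (d\<^sup>2 / a + a) / 2\<close> for every \<open>a > 0\<close>. By
  strong convexity \<open>d\<^sup>2\<close> is at most a multiple of the divergence, whose expectation is bounded. Taking
  for \<open>a\<close> the square root of the resulting bound on the mean of \<open>d\<^sup>2\<close> gives \<open>a\<close> as a bound on the
  mean of \<open>d\<close>, and the pathwise bound also gives integrability.
\<close>

lemma expected_lipschitz_loss:
  assumes k: "k \<in> {1..K}" and e: "eps k > 0"
    and L: "lipschitz_wrt N L Y phi"
    and int: "integrable M (\<lambda>\<omega>. phi (u k \<omega>))"
  shows "integrable M (\<lambda>\<omega>. phi (y k \<omega>))"
    and "(\<integral>\<omega>. phi (u k \<omega>) \<partial>M) - (\<integral>\<omega>. phi (y k \<omega>) \<partial>M) \<le> L * sqrt (2 / \<mu> * (eps k / Lam k))"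
proof -
  define a where "a = sqrt (2 / \<mu> * (eps k / Lam k))"
  have a: "a > 0" and a2: "a * a = 2 / \<mu> * (eps k / Lam k)"
    using e Lam_pos[OF k] \<mu>_pos by (simp_all add: a_def)
  have L0: "L \<ge> 0" using L by (simp add: lipschitz_wrt_def)
  define W where "W \<omega> = L / 2 * (2 / \<mu> * bregman r (y k \<omega>) (u k \<omega>) / a + a)" for \<omega>
  note B = expected_bregman_response[OF k e]
  have intW: "integrable M W"
    unfolding W_def using B(1) by (intro integrable_mult_right Bochner_Integration.integrable_add integrable_divide) simp_all
  have diff: "\<bar>phi (u k \<omega>) - phi (y k \<omega>)\<bar> \<le> W \<omega>" if \<omega>: "\<omega> \<in> space M" for \<omega>
  proof -
    have u: "u k \<omega> \<in> U \<inter> interior P" "u k \<omega> \<in> Y" and y: "y k \<omega> \<in> U \<inter> interior P" "y k \<omega> \<in> Y"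
      using dual_maximizer_interior[OF k \<omega>] response_interior[OF _ \<omega>, of k] k Y_subset_U by auto
    let ?d = "N (u k \<omega> - y k \<omega>)"
    have "\<mu> / 2 * ?d\<^sup>2 \<le> bregman r (y k \<omega>) (u k \<omega>)" by (rule bregman_strongly_convex[OF y(1) u(1)])
    then have d2: "?d\<^sup>2 \<le> 2 / \<mu> * bregman r (y k \<omega>) (u k \<omega>)" using \<mu>_pos by (simp add: field_simps)
    have "0 \<le> (?d - a)\<^sup>2" by simp
    then have "2 * ?d * a \<le> ?d\<^sup>2 + a * a" by (simp add: power2_eq_square algebra_simps)
    also have "\<dots> \<le> 2 / \<mu> * bregman r (y k \<omega>) (u k \<omega>) + a * a" using d2 by simp
    finally have *: "2 * ?d * a \<le> 2 / \<mu> * bregman r (y k \<omega>) (u k \<omega>) + a * a" .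
    have "?d \<le> 1 / 2 * (2 / \<mu> * bregman r (y k \<omega>) (u k \<omega>) / a + a)"
    proof -
      have "2 * ?d \<le> (2 / \<mu> * bregman r (y k \<omega>) (u k \<omega>) + a * a) / a"
        using * a by (simp only: pos_le_divide_eq)
      then show ?thesis using a by (simp add: add_divide_distrib)
    qed
    then have "L * ?d \<le> L * (1 / 2 * (2 / \<mu> * bregman r (y k \<omega>) (u k \<omega>) / a + a))"
      using L0 by (rule mult_left_mono)
    moreover have "\<bar>phi (u k \<omega>) - phi (y k \<omega>)\<bar> \<le> L * ?d"
      using L u y by (auto simp: lipschitz_wrt_def)
    ultimately show ?thesis by (simp add: W_def)
  qed
  have ym: "y k \<in> borel_measurable M" by (rule response_measurable[OF refl _ iterate_measurable]) (use k in auto)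
  show int': "integrable M (\<lambda>\<omega>. phi (y k \<omega>))"
  proof (rule Bochner_Integration.integrable_bound)
    show "integrable M (\<lambda>\<omega>. \<bar>phi (u k \<omega>)\<bar> + \<bar>W \<omega>\<bar>)"
      using intW int by (intro Bochner_Integration.integrable_add integrable_abs)
    show "(\<lambda>\<omega>. phi (y k \<omega>)) \<in> borel_measurable M"
      by (rule measurable_compose[OF ym borel_measurable_continuous_onI[OF dual_objective_continuous]])
    show "AE \<omega> in M. norm (phi (y k \<omega>)) \<le> norm (\<bar>phi (u k \<omega>)\<bar> + \<bar>W \<omega>\<bar>)"
    proof (rule AE_I2)
      fix \<omega> assume "\<omega> \<in> space M"
      then show "norm (phi (y k \<omega>)) \<le> norm (\<bar>phi (u k \<omega>)\<bar> + \<bar>W \<omega>\<bar>)" using diff[of \<omega>] by simp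
    qed
  qed
  have "(\<integral>\<omega>. phi (u k \<omega>) \<partial>M) - (\<integral>\<omega>. phi (y k \<omega>) \<partial>M) = (\<integral>\<omega>. phi (u k \<omega>) - phi (y k \<omega>) \<partial>M)"
    using int int' by simp
  also have "\<dots> \<le> (\<integral>\<omega>. W \<omega> \<partial>M)"
    by (rule integral_mono) (use int int' intW diff in \<open>auto simp: abs_le_iff\<close>)
  also have "\<dots> = L / 2 * (2 / \<mu> * (\<integral>\<omega>. bregman r (y k \<omega>) (u k \<omega>) \<partial>M) / a + a)"
    unfolding W_def using B(1) by (simp add: prob_space)
  also have "\<dots> \<le> L / 2 * (2 / \<mu> * (eps k / Lam k) / a + a)"
    using L0 a \<mu>_pos B(2) by (intro mult_left_mono add_right_mono divide_right_mono) auto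
  also have "\<dots> = L * a" unfolding a2[symmetric] using a by simp
  finally show "(\<integral>\<omega>. phi (u k \<omega>) \<partial>M) - (\<integral>\<omega>. phi (y k \<omega>) \<partial>M) \<le> L * sqrt (2 / \<mu> * (eps k / Lam k))"
    by (simp add: a_def)
qed

end

theorem theorem4:
  fixes psi :: "real^'d \<Rightarrow> real^'n \<Rightarrow> real"
    and X :: "(real^'d) set" and Y U P :: "(real^'n) set"
    and N r :: "real^'n \<Rightarrow> real" and \<mu> :: real
    and y0 ystar :: "real^'n" and K :: nat and lam eps :: "nat \<Rightarrow> real"
    and M :: "'w measure"
    and q y :: "nat \<Rightarrow> 'w \<Rightarrow> real^'n" and x :: "nat \<Rightarrow> 'w \<Rightarrow> real^'d"
  assumes des: "dual_extraction_setup psi X Y U P N r \<mu>"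
    and y0: "y0 \<in> Y \<inter> interior P"
    and K: "K \<ge> 1"
    and lam: "\<And>j. j < K \<Longrightarrow> lam j > 0"
    and eps: "\<And>k. k \<in> {1..K} \<Longrightarrow> eps k > 0"
    and ystar: "is_arg_max (dual_objective psi X) (\<lambda>v. v \<in> Y) ystar"
    and prob: "prob_space M"
    and run: "dual_extraction_run M psi X Y U r y0 K lam eps q x y"
  shows "(\<forall>\<omega>\<in>space M. y K \<omega> \<in> Y \<inter> interior P) \<and>
    (\<exists>u. u \<in> borel_measurable M \<and> (\<forall>\<omega>\<in>space M. u \<omega> \<in> Y) \<and>
       integrable M (\<lambda>\<omega>. bregman r (y K \<omega>) (u \<omega>)) \<and>
       (\<integral>\<omega>. bregman r (y K \<omega>) (u \<omega>) \<partial>M) \<le> eps K / cumulative lam K \<and>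
       integrable M (\<lambda>\<omega>. dual_objective psi X (u \<omega>)) \<and>
       dual_objective psi X ystar - (\<integral>\<omega>. dual_objective psi X (u \<omega>) \<partial>M)
         \<le> lam 0 * bregman r y0 ystar
           + (\<Sum>k=1..K-1. lam k / cumulative lam k * eps k)) \<and>
    (\<forall>L. lipschitz_wrt N L Y (dual_objective psi X) \<longrightarrow>
       integrable M (\<lambda>\<omega>. dual_objective psi X (y K \<omega>)) \<and>
       dual_objective psi X ystar - (\<integral>\<omega>. dual_objective psi X (y K \<omega>) \<partial>M)
         \<le> lam 0 * bregman r y0 ystar
           + (\<Sum>k=1..K-1. lam k / cumulative lam k * eps k)
           + L * sqrt (2 / \<mu> * (eps K / cumulative lam K)))"
proof -
  interpret dual_extraction_execution psi X Y U P N r \<mu> M y0 K lam eps q y x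
    using des prob y0 lam run
    by (intro dual_extraction_execution.intro dual_extraction_execution_axioms.intro)
  have KK: "K \<in> {1..K}" using K by simp
  note subopt = expected_suboptimality[OF K eps ystar]
  show ?thesis
  proof (intro conjI exI[of _ "u K"] allI impI ballI)
    show "y K \<omega> \<in> Y \<inter> interior P" if "\<omega> \<in> space M" for \<omega>
      by (rule response_interior[OF order_refl that])
    show "u K \<in> borel_measurable M" by (rule dual_maximizer_measurable[OF KK])
    show "u K \<omega> \<in> Y" if "\<omega> \<in> space M" for \<omega>
      using dual_maximizer_interior[OF KK that] by simp
    show "integrable M (\<lambda>\<omega>. bregman r (y K \<omega>) (u K \<omega>))"
      "(\<integral>\<omega>. bregman r (y K \<omega>) (u K \<omega>) \<partial>M) \<le> eps K / cumulative lam K"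
      by (rule expected_bregman_response[OF KK eps[OF KK]])+
    show "integrable M (\<lambda>\<omega>. phi (u K \<omega>))"
      "phi ystar - (\<integral>\<omega>. phi (u K \<omega>) \<partial>M)
        \<le> lam 0 * bregman r y0 ystar + (\<Sum>k=1..K-1. lam k / cumulative lam k * eps k)"
      by (rule subopt, assumption)+
    fix L assume L: "lipschitz_wrt N L Y phi"
    have int: "integrable M (\<lambda>\<omega>. phi (u K \<omega>))" by (rule subopt)
    show "integrable M (\<lambda>\<omega>. phi (y K \<omega>))"
      by (rule expected_lipschitz_loss(1)[OF KK eps[OF KK] L int])
    show "phi ystar - (\<integral>\<omega>. phi (y K \<omega>) \<partial>M)
        \<le> lam 0 * bregman r y0 ystar + (\<Sum>k=1..K-1. lam k / cumulative lam k * eps k)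
          + L * sqrt (2 / \<mu> * (eps K / cumulative lam K))"
    proof -
      have "phi ystar - (\<integral>\<omega>. phi (u K \<omega>) \<partial>M)
        \<le> lam 0 * bregman r y0 ystar + (\<Sum>k=1..K-1. lam k / cumulative lam k * eps k)"
        by (rule subopt)
      then show ?thesis using expected_lipschitz_loss(2)[OF KK eps[OF KK] L int] by linarith
    qed
  qed
qed

end
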